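(* For each $\alpha\in(\pi,3\pi/2)$, the random measure $\nu_\alpha$ satisfies $$\forall\,A,B\in\mathcal F:\quad \lim_{t\to\infty}\mathbb P\big(A\cap\tau_t^{-1}(B)\big)=\mathbb P(A)\,\mathbb P(B),$$ where $\mathcal F=\sigma\{\nu_\alpha((a,b]):a\le b\in\mathbb R\}$ and $\tau_t$ is translation of the weighted Poisson points by $(t,0)$. In particular, $\nu_\alpha$ is ergodic.
   Context: Model. Let $\mathbf P\subset\mathbb R^2$ be a Poisson point process of intensity one. To each $\mathbf p\in\mathbf P$ attach a positive weight $\omega_{\mathbf p}$; the weights are i.i.d. with distribution function $F$ and independent of $\mathbf P$. Assume that $\int_0^\infty e^{ax}\,dF(x)<\infty$ for some $a>0$. Write $\mathbf p\le\mathbf q$ for inequality in each coordinate. For $\mathbf p\le\mathbf q$, let $\Pi(\mathbf p,\mathbf q)$ be the set of up-right (coordinatewise nondecreasing) paths from $\mathbf p$ to $\mathbf q$ consisting of points of $\mathbf P$ in the rectangle between $\mathbf p$ and $\mathbf q$, with the starting point $\mathbf p$ excluded, and put $L(\mathbf p,\mathbf q)=\max_{\varpi\in\Pi(\mathbf p,\mathbf q)}\sum_{\mathbf p'\in\varpi}\omega_{\mathbf p'}$ (equal to $0$ if there are no points). Geodesics and rays. A path through ordered points is identified with the lowest increasing continuous curve through them and its endpoints. The geodesic $\varpi(\mathbf p,\mathbf q)$ is the lowest path attaining the maximum in $L(\mathbf p,\mathbf q)$. For $\alpha\in(\pi,3\pi/2)$, an $\alpha$-ray from $\mathbf x$ is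 the lowest continuous down-left path through a sequence $(\mathbf p_i)_{i\ge0}$ with $\mathbf p_0=\mathbf x$, $\mathbf p_i\in\mathbf P$ for $i\ge1$, $\mathbf p_i\ge\mathbf p_j$ for $i\le j$, every part of which is a geodesic ($\varpi(\mathbf p_j,\mathbf p_i)$ is contained in the ray), and with $\mathbf p_i/\|\mathbf p_i\|\to(\cos\alpha,\sin\alpha)$. For fixed $\alpha$ it is known that, with probability one, every $\mathbf x\in\mathbb R^2$ has a unique $\alpha$-ray $\varpi_\alpha(\mathbf x)$, that $\varpi(\mathbf x,\mathbf z_n)\to\varpi_\alpha(\mathbf x)$ (eventual equality on bounded sets) whenever $\|\mathbf z_n\|\to\infty$ and $\mathbf z_n/\|\mathbf z_n\|\to(\cos\alpha,\sin\alpha)$, and that any two $\alpha$-rays $\varpi_\alpha(\mathbf x),\varpi_\alpha(\mathbf y)$ coalesce at some point $\mathbf c=\mathbf c(\alpha,\mathbf x,\mathbf y)$. Busemann function. $B_\alpha(\mathbf x,\mathbf y)=L(\mathbf c,\mathbf y)-L(\mathbf c,\mathbf x)$ with $\mathbf c=\mathbf c(\alpha,\mathbf x,\mathbf y)$ (the value does not depend on which coalescence point is used). The random measure $\nu_\alpha$ on $\mathbb R$ is given by $\nu_\alpha((x,y])=B_\alpha((x,0),(y,0))$ for $x\le y$. Translations. The sample space $\Omega$ is that of the compound Poisson process, and $\tau_t:\Omega\to\Omega$ translates all Poisson points (carrying their weights) by the vector $(t,0)$. Ergodic means that events in $\mathcal F$ invariant under all spatial translations have probability $0$ or $1$. *)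

theory Defs
  imports "HOL-Probability.Probability"
begin

section \<open>Weighted Poisson points\<close>

text \<open>
  The order on \<open>real \<times> real\<close> is the coordinatewise one and the norm is Euclidean.
  A configuration of weighted points is a function: its value at \<open>p\<close> is the weight of \<open>p\<close> if
  \<open>p\<close> is a point of the process, and 0 otherwise. Nothing is lost, since weights are positive.
\<close>

type_synonym point = "real \<times> real"
type_synonym config = "point \<Rightarrow> real"

definition points :: "config \<Rightarrow> point set" where
  "points c = {p. 0 < c p}"

definition configs :: "config set" where
  "configs = {c. (\<forall>p. 0 \<le> c p) \<and> (\<forall>K. bounded K \<longrightarrow> finite (points c \<inter> K))}"

definition config_algebra :: "config measure" where
  "config_algebra = sigma configs
     {{c \<in> configs. card {p \<in> D. c p \<in> E} = n} | D E n.
        D \<in> sets borel \<and> bounded D \<and> E \<in> sets borel \<and> E \<subseteq> {0<..}}"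

definition translate :: "real \<Rightarrow> config \<Rightarrow> config" where
  "translate t c = (\<lambda>p. c (p - (t, 0)))"

text \<open>
  Intensity one. The Poisson probabilities are written out because \<open>poisson_pmf\<close> is unspecified
  at rate 0, which occurs here for null sets \<open>D\<close>.
\<close>

definition poisson_points :: "config measure \<Rightarrow> bool" where
  "poisson_points M \<longleftrightarrow>
     (\<forall>D \<in> sets borel. bounded D \<longrightarrow>
        (\<forall>k. measure M {c \<in> space M. card (points c \<inter> D) = k}
           = measure lborel D ^ k / fact k * exp (- measure lborel D))) \<and>
     (\<forall>D :: nat \<Rightarrow> point set.
        disjoint_family D \<and> (\<forall>i. D i \<in> sets borel \<and> bounded (D i)) \<longrightarrow>
        prob_space.indep_vars M (\<lambda>_. count_space UNIV) (\<lambda>i c. card (points c \<inter> D i)) UNIV)"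

text \<open>
  The points are almost surely infinite in number. That the weights are i.i.d. with law \<open>W\<close> and
  independent of the points is expressed through some measurable enumeration
  \<open>X 0, X 1, \<dots>\<close> of the points: the weights \<open>c (X n c)\<close> form an i.i.d. sequence, which is
  independent of the sequence \<open>X\<close>.
\<close>

definition compound_poisson :: "real measure \<Rightarrow> config measure \<Rightarrow> bool" where
  "compound_poisson W M \<longleftrightarrow>
     prob_space M \<and> space M = configs \<and> sets M = sets config_algebra \<and> poisson_points M \<and>
     (\<exists>X :: nat \<Rightarrow> config \<Rightarrow> point.
        (\<forall>n. X n \<in> borel_measurable M) \<and>
        (AE c in M. bij_betw (\<lambda>n. X n c) UNIV (points c)) \<and>
        prob_space.indep_vars M (\<lambda>_. borel) (\<lambda>n c. c (X n c)) UNIV \<and>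
        (\<forall>n. distr M borel (\<lambda>c. c (X n c)) = W) \<and>
        prob_space.indep_set M
          (sets (vimage_algebra (space M) (\<lambda>c n. X n c) (\<Pi>\<^sub>M n\<in>UNIV. borel)))
          (sets (vimage_algebra (space M) (\<lambda>c n. c (X n c)) (\<Pi>\<^sub>M n\<in>UNIV. borel))))"


section \<open>Last passage percolation and geodesics\<close>

definition up_right_paths :: "config \<Rightarrow> point \<Rightarrow> point \<Rightarrow> point set set" where
  "up_right_paths c p q =
     {S. S \<subseteq> points c \<inter> {p..q} - {p} \<and> (\<forall>r\<in>S. \<forall>s\<in>S. r \<le> s \<or> s \<le> r)}"

definition last_passage :: "config \<Rightarrow> point \<Rightarrow> point \<Rightarrow> real" where
  "last_passage c p q = Max ((\<lambda>S. \<Sum>r\<in>S. c r) ` up_right_paths c p q)"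

text \<open>
  Curves are point sets. A curve through \<open>Q\<close> stays in the rectangles spanned by points of \<open>Q\<close>,
  so it has no parts beyond the endpoints. This covers both finite paths, where \<open>Q\<close> has a least
  and a greatest element, and rays, where \<open>Q\<close> only has a greatest element.
\<close>

definition increasing_curve :: "point set \<Rightarrow> bool" where
  "increasing_curve C \<longleftrightarrow>
     (\<exists>(I :: real set) g. is_interval I \<and> continuous_on I g \<and> mono_on I g \<and> C = g ` I)"

definition curve_through :: "point set \<Rightarrow> point set \<Rightarrow> bool" where
  "curve_through Q C \<longleftrightarrow>
     increasing_curve C \<and> Q \<subseteq> C \<and> C \<subseteq> (\<Union>a\<in>Q. \<Union>b\<in>Q. {a..b})"

text \<open>
  Every point of the lower curve has a point of the other one weakly to the north-west of it;
  unlike a comparison of heights, this makes sense for curves with vertical pieces.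
\<close>

definition lies_below :: "point set \<Rightarrow> point set \<Rightarrow> bool" where
  "lies_below C C' \<longleftrightarrow> (\<forall>s\<in>C. \<exists>t\<in>C'. fst t \<le> fst s \<and> snd s \<le> snd t)"

definition lowest_curve_through :: "point set \<Rightarrow> point set \<Rightarrow> bool" where
  "lowest_curve_through Q C \<longleftrightarrow>
     curve_through Q C \<and> (\<forall>C'. curve_through Q C' \<longrightarrow> lies_below C C')"

definition maximal_path_curve :: "config \<Rightarrow> point \<Rightarrow> point \<Rightarrow> point set \<Rightarrow> bool" where
  "maximal_path_curve c p q C \<longleftrightarrow>
     (\<exists>S \<in> up_right_paths c p q.
        (\<Sum>r\<in>S. c r) = last_passage c p q \<and> lowest_curve_through ({p, q} \<union> S) C)"

definition is_geodesic :: "config \<Rightarrow> point \<Rightarrow> point \<Rightarrow> point set \<Rightarrow> bool" where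
  "is_geodesic c p q G \<longleftrightarrow>
     p \<le> q \<and> maximal_path_curve c p q G \<and>
     (\<forall>G'. maximal_path_curve c p q G' \<longrightarrow> lies_below G G')"


section \<open>Rays and the Busemann function\<close>

definition has_direction :: "real \<Rightarrow> (nat \<Rightarrow> point) \<Rightarrow> bool" where
  "has_direction \<alpha> z \<longleftrightarrow> (\<lambda>n. z n /\<^sub>R norm (z n)) \<longlonglongrightarrow> (cos \<alpha>, sin \<alpha>)"

text \<open>Injectivity excludes sequences that stop at some point, whose curve would be finite.\<close>

definition is_ray :: "real \<Rightarrow> config \<Rightarrow> point \<Rightarrow> point set \<Rightarrow> bool" where
  "is_ray \<alpha> c x R \<longleftrightarrow>
     (\<exists>p :: nat \<Rightarrow> point.
        p 0 = x \<and> inj p \<and> (\<forall>i\<ge>1. p i \<in> points c) \<and> (\<forall>i j. i \<le> j \<longrightarrow> p j \<le> p i) \<and>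
        lowest_curve_through (range p) R \<and>
        (\<forall>i j. i \<le> j \<longrightarrow> (\<exists>G. is_geodesic c (p j) (p i) G \<and> G \<subseteq> R)) \<and>
        has_direction \<alpha> p)"

definition ray :: "real \<Rightarrow> config \<Rightarrow> point \<Rightarrow> point set" where
  "ray \<alpha> c x = (THE R. is_ray \<alpha> c x R)"

definition coalescence_point :: "real \<Rightarrow> config \<Rightarrow> point \<Rightarrow> point \<Rightarrow> point \<Rightarrow> bool" where
  "coalescence_point \<alpha> c x y z \<longleftrightarrow>
     z \<in> ray \<alpha> c x \<and> z \<in> ray \<alpha> c y \<and> ray \<alpha> c x \<inter> {..z} = ray \<alpha> c y \<inter> {..z}"

definition busemann :: "real \<Rightarrow> config \<Rightarrow> point \<Rightarrow> point \<Rightarrow> real" where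
  "busemann \<alpha> c x y =
     (let z = (SOME z. coalescence_point \<alpha> c x y z) in last_passage c z y - last_passage c z x)"

definition busemann_measure :: "real \<Rightarrow> config \<Rightarrow> real measure \<Rightarrow> bool" where
  "busemann_measure \<alpha> c N \<longleftrightarrow>
     sets N = sets borel \<and>
     (\<forall>a b. a \<le> b \<longrightarrow> emeasure N {a<..b} = ennreal (busemann \<alpha> c (a, 0) (b, 0)))"

text \<open>
  The almost sure properties of rays in a fixed direction on which the definition of the
  Busemann function rests: existence and uniqueness of the ray from every point, convergence of
  geodesics to rays (with respect to eventual equality on bounded sets), and coalescence.
\<close>

definition rays_exist_uniquely :: "real \<Rightarrow> config \<Rightarrow> bool" where
  "rays_exist_uniquely \<alpha> c \<longleftrightarrow> (\<forall>x. \<exists>!R. is_ray \<alpha> c x R)"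

definition geodesics_converge :: "real \<Rightarrow> config \<Rightarrow> bool" where
  "geodesics_converge \<alpha> c \<longleftrightarrow>
     (\<forall>x z. filterlim (\<lambda>n. norm (z n)) at_top sequentially \<and> has_direction \<alpha> z \<longrightarrow>
        (\<forall>K. bounded K \<longrightarrow>
           (\<forall>\<^sub>F n in sequentially. \<exists>G. is_geodesic c (z n) x G \<and> G \<inter> K = ray \<alpha> c x \<inter> K)))"

definition rays_coalesce :: "real \<Rightarrow> config \<Rightarrow> bool" where
  "rays_coalesce \<alpha> c \<longleftrightarrow> (\<forall>x y. \<exists>z. coalescence_point \<alpha> c x y z)"


section \<open>Mixing and ergodicity of random measures\<close>

text \<open>
  A random measure \<open>\<nu>\<close> that is determined only almost surely has increment events in the
  completion of \<open>M\<close>, so probabilities of such events are taken there.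
\<close>

definition increment_events :: "config measure \<Rightarrow> (config \<Rightarrow> real measure) \<Rightarrow> config set set" where
  "increment_events M \<nu> = sigma_sets (space M)
     {{c \<in> space M. emeasure (\<nu> c) {a<..b} \<in> U} | a b U. a \<le> b \<and> U \<in> sets borel}"

definition translate_preimage :: "config measure \<Rightarrow> real \<Rightarrow> config set \<Rightarrow> config set" where
  "translate_preimage M t B = {c \<in> space M. translate t c \<in> B}"

definition mixing :: "config measure \<Rightarrow> config set set \<Rightarrow> bool" where
  "mixing M \<F> \<longleftrightarrow>
     (\<forall>A\<in>\<F>. \<forall>B\<in>\<F>.
        ((\<lambda>t. measure M (A \<inter> translate_preimage M t B)) \<longlongrightarrow> measure M A * measure M B) at_top)"

definition ergodic :: "config measure \<Rightarrow> config set set \<Rightarrow> bool" where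
  "ergodic M \<F> \<longleftrightarrow>
     (\<forall>A\<in>\<F>. (\<forall>t. translate_preimage M t A = A) \<longrightarrow> measure M A = 0 \<or> measure M A = 1)"

end

theory Submission
  imports Defs
begin

text \<open>
  The increments of \<open>\<nu>\<close> are almost surely limits of differences of last passage times from far away
  points \<open>z\<^sub>n\<close> in direction \<open>\<alpha>\<close>: the geodesics from \<open>z\<^sub>n\<close> to \<open>x\<close> and \<open>y\<close> eventually pass through
  a coalescence point, where last passage times are additive. So increment events are events of the
  completed compound Poisson process, and it suffices that this process is mixing under
  translations. It is stationary and independent over disjoint regions, hence events that depend on
  bounded regions become independent once one of them is translated far enough, and a Dynkin class
  argument extends mixing to all events.
\<close>

section \<open>Additivity of last passage times along geodesics\<close>

text \<open>The weights are attached through an enumeration \<open>X\<close> of the points that need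
  not commute with translations, and the indices of the points in a given region are random.
  Stationarity and independence over disjoint regions are therefore not part of the model for the
  weighted points and have to be derived. The key is to condition on these index sets: almost surely
  they are finite, so they take countably many values, and they are independent of the weights.
  Given them, an event about counts concerns i.i.d. weights at deterministic indices, and by
  exchangeability its probability depends only on the numbers of points in the atoms generated by
  the regions. These numbers are independent Poisson variables whose means are the areas of the
  atoms; translations preserve areas, and disjoint regions have disjoint atoms.

  A second obstacle is that neither the coalescence point in the Busemann function, picked by
  choice, nor \<open>\<nu>\<close> itself is known to be measurable. Limits along a deterministic
  sequence replace the former, and the completion absorbs the null sets.\<close>

lemma finite_up_right_paths:
  assumes "c \<in> configs"
  shows "finite (up_right_paths c p q)"
    and "S \<in> up_right_paths c p q \<Longrightarrow> finite S"
proof -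
  have fin: "finite (points c \<inter> {p..q})"
    using assms by (auto simp: configs_def)
  have sub: "up_right_paths c p q \<subseteq> Pow (points c \<inter> {p..q})"
    by (auto simp: up_right_paths_def)
  show "finite (up_right_paths c p q)"
    using sub fin by (meson finite_Pow_iff finite_subset)
  show "finite S" if "S \<in> up_right_paths c p q"
    using that sub fin by (meson PowD finite_subset subsetD)
qed

lemma empty_path: "{} \<in> up_right_paths c p q"
  by (simp add: up_right_paths_def)

lemma last_passage_upper:
  assumes "c \<in> configs" "S \<in> up_right_paths c p q"
  shows "sum c S \<le> last_passage c p q"
  unfolding last_passage_def using assms finite_up_right_paths(1) by (intro Max_ge) auto

lemma last_passage_attained:
  assumes "c \<in> configs"
  obtains S where "S \<in> up_right_paths c p q" "sum c S = last_passage c p q"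
proof -
  have "last_passage c p q \<in> sum c ` up_right_paths c p q"
    unfolding last_passage_def using assms finite_up_right_paths(1) empty_path[of c p q]
    by (intro Max_in) auto
  then show ?thesis using that by auto
qed

text \<open>Maximal paths for the two pieces concatenate at \<open>z\<close> to an admissible path
  from \<open>p\<close> to \<open>q\<close>.\<close>

lemma last_passage_superadditive:
  assumes c: "c \<in> configs" and le: "p \<le> z" "z \<le> q"
  shows "last_passage c p z + last_passage c z q \<le> last_passage c p q"
proof -
  obtain S where S: "S \<in> up_right_paths c p z" "sum c S = last_passage c p z"
    using c by (rule last_passage_attained)
  obtain T where T: "T \<in> up_right_paths c z q" "sum c T = last_passage c z q"
    using c by (rule last_passage_attained)
  have S': "S \<subseteq> points c" "\<forall>s\<in>S. p \<le> s \<and> s \<le> z \<and> s \<noteq> p" "\<forall>r\<in>S. \<forall>s\<in>S. r \<le> s \<or> s \<le> r"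
    and T': "T \<subseteq> points c" "\<forall>s\<in>T. z \<le> s \<and> s \<le> q \<and> s \<noteq> z" "\<forall>r\<in>T. \<forall>s\<in>T. r \<le> s \<or> s \<le> r"
    using S(1) T(1) by (auto simp: up_right_paths_def)
  \<comment> \<open>A common point would be both below and above \<open>z\<close>, hence equal to
    \<open>z\<close>. But \<open>T\<close> omits its starting point, so a Poisson point at
    \<open>z\<close> is counted once, in \<open>S\<close>.\<close>
  have disj: "S \<inter> T = {}"
    using S'(2) T'(2) by (metis disjoint_iff order_antisym)
  have "\<forall>s\<in>S \<union> T. p \<le> s \<and> s \<le> q \<and> s \<noteq> p"
    using S'(2) T'(2) le by (metis UnE order_antisym order_trans)
  moreover have "\<forall>r\<in>S \<union> T. \<forall>s\<in>S \<union> T. r \<le> s \<or> s \<le> r"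
    using S'(2,3) T'(2,3) by (metis UnE order_trans)
  ultimately have "S \<union> T \<in> up_right_paths c p q"
    using S'(1) T'(1) by (auto simp: up_right_paths_def)
  then have "sum c (S \<union> T) \<le> last_passage c p q"
    using c by (rule last_passage_upper[rotated])
  moreover have "sum c (S \<union> T) = sum c S + sum c T"
    using disj S(1) T(1) c finite_up_right_paths(2) by (intro sum.union_disjoint) auto
  ultimately show ?thesis using S T by simp
qed

text \<open>A geodesic is totally ordered, so every point of the maximal path \<open>S\<close> is
  comparable with \<open>z\<close> and \<open>S\<close> can be cut there. The point \<open>z\<close>
  need not be a Poisson point; if it belongs to \<open>S\<close>, it falls into the lower
  piece.\<close>

lemma last_passage_through:
  assumes c: "c \<in> configs" and G: "is_geodesic c p q G" and z: "z \<in> G"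
  shows "last_passage c p q = last_passage c p z + last_passage c z q"
proof (rule antisym)
  from G obtain S where S: "S \<in> up_right_paths c p q" "sum c S = last_passage c p q"
    and curve: "curve_through ({p, q} \<union> S) G" and pq: "p \<le> q"
    by (auto simp: is_geodesic_def maximal_path_curve_def lowest_curve_through_def)
  have S': "S \<subseteq> points c" "\<forall>s\<in>S. p \<le> s \<and> s \<le> q \<and> s \<noteq> p" "\<forall>r\<in>S. \<forall>s\<in>S. r \<le> s \<or> s \<le> r"
    using S(1) by (auto simp: up_right_paths_def)
  obtain a b where "a \<in> {p, q} \<union> S" "b \<in> {p, q} \<union> S" "a \<le> z" "z \<le> b"
    using curve z unfolding curve_through_def subset_iff UN_iff atLeastAtMost_iff by metis
  then have le: "p \<le> z" "z \<le> q"
    using S'(2) pq by (auto intro: order_trans)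
  show "last_passage c p z + last_passage c z q \<le> last_passage c p q"
    using c le by (rule last_passage_superadditive)
  obtain I :: "real set" and g where g: "mono_on I g" "G = g ` I"
    using curve unfolding curve_through_def increasing_curve_def by blast
  have total: "r \<le> s \<or> s \<le> r" if r: "r \<in> G" and s: "s \<in> G" for r s
  proof -
    obtain t u where "t \<in> I" "r = g t" "u \<in> I" "s = g u"
      using r s g(2) by blast
    then show ?thesis
      using g(1) linear[of t u] by (auto dest: mono_onD)
  qed
  have "S \<subseteq> G" using curve by (simp add: curve_through_def)
  then have comp: "\<forall>s\<in>S. s \<le> z \<or> z \<le> s" using total z by blast
  have "S \<inter> {..z} \<in> up_right_paths c p z"
    using S' by (auto simp: up_right_paths_def)
  moreover have "S - {..z} \<in> up_right_paths c z q"
    using S' comp by (auto simp: up_right_paths_def)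
  ultimately have "sum c (S \<inter> {..z}) + sum c (S - {..z}) \<le> last_passage c p z + last_passage c z q"
    using c by (intro add_mono last_passage_upper)
  then show "last_passage c p q \<le> last_passage c p z + last_passage c z q"
    using sum.Int_Diff[of S c "{..z}"] finite_up_right_paths(2)[OF c S(1)] S(2) by simp
qed

section \<open>Busemann increments as limits along a deterministic sequence\<close>

definition far_point :: "real \<Rightarrow> nat \<Rightarrow> point" where
  "far_point \<alpha> n = real n *\<^sub>R (cos \<alpha>, sin \<alpha>)"

lemma norm_far_point: "norm (far_point \<alpha> n) = real n"
  unfolding far_point_def norm_scaleR by (simp add: norm_Pair)

lemma far_point_direction: "has_direction \<alpha> (far_point \<alpha>)"
proof -
  have "far_point \<alpha> n /\<^sub>R norm (far_point \<alpha> n) = (cos \<alpha>, sin \<alpha>)" if "n > 0" for n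
    using that unfolding norm_far_point by (simp add: far_point_def)
  then show ?thesis
    unfolding has_direction_def
    by (intro tendsto_eventually eventually_mono[OF eventually_gt_at_top[of 0]]) auto
qed

lemma filterlim_norm_far_point: "filterlim (\<lambda>n. norm (far_point \<alpha> n)) at_top sequentially"
  by (simp add: norm_far_point filterlim_real_sequentially)

text \<open>The sequence is eventually constant: once both geodesics pass through the coalescence
  point \<open>z\<close>, the term \<open>last_passage c (far_point \<alpha> n) z\<close> cancels.
  The right-hand side no longer mentions \<open>z\<close>, whose choice by \<open>SOME\<close> gives
  no measurable dependence on \<open>c\<close>.\<close>

lemma busemann_eq_lim:
  assumes c: "c \<in> configs" and conv: "geodesics_converge \<alpha> c" and coal: "rays_coalesce \<alpha> c"
  shows "busemann \<alpha> c x y =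
    lim (\<lambda>n. last_passage c (far_point \<alpha> n) y - last_passage c (far_point \<alpha> n) x)"
proof -
  define z where "z = (SOME z. coalescence_point \<alpha> c x y z)"
  have "coalescence_point \<alpha> c x y z"
    using coal unfolding z_def rays_coalesce_def by (metis someI_ex)
  then have z: "z \<in> ray \<alpha> c x" "z \<in> ray \<alpha> c y"
    by (auto simp: coalescence_point_def)
  have ev: "\<forall>\<^sub>F n in sequentially. last_passage c (far_point \<alpha> n) w =
      last_passage c (far_point \<alpha> n) z + last_passage c z w" if "z \<in> ray \<alpha> c w" for w
  proof -
    \<comment> \<open>The singleton of \<open>z\<close> serves as the bounded set: agreement with
      the ray there says exactly that \<open>z\<close> lies on the geodesic.\<close>
    have "\<forall>\<^sub>F n in sequentially. \<exists>G. is_geodesic c (far_point \<alpha> n) w G \<and> G \<inter> {z} = ray \<alpha> c w \<inter> {z}"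
      using conv filterlim_norm_far_point far_point_direction
      unfolding geodesics_converge_def by (meson bounded_insert bounded_empty)
    then show ?thesis
      by eventually_elim (use that last_passage_through[OF c] in blast)
  qed
  have "\<forall>\<^sub>F n in sequentially. last_passage c (far_point \<alpha> n) y - last_passage c (far_point \<alpha> n) x =
      last_passage c z y - last_passage c z x"
    using ev[OF z(1)] ev[OF z(2)] by eventually_elim simp
  then have "(\<lambda>n. last_passage c (far_point \<alpha> n) y - last_passage c (far_point \<alpha> n) x)
      \<longlonglongrightarrow> last_passage c z y - last_passage c z x"
    by (rule tendsto_eventually)
  then show ?thesis
    by (simp add: busemann_def z_def[symmetric] limI)
qed

section \<open>Measurability\<close>

text \<open>The maximum runs over paths that depend on \<open>c\<close>. Reading them through the
  enumeration turns it into a supremum over the countably many finite sets of indices. The agreement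
  is almost sure because \<open>X\<close> enumerates the points only almost surely.\<close>

lemma last_passage_AE_measurable:
  assumes "compound_poisson W M"
  obtains f where "f \<in> borel_measurable M" "AE c in M. last_passage c p q = f c"
proof -
  interpret prob_space M using assms by (simp add: compound_poisson_def)
  from assms obtain X :: "nat \<Rightarrow> config \<Rightarrow> point"
    where X[measurable]: "\<And>n. X n \<in> borel_measurable M"
      and bij: "AE c in M. bij_betw (\<lambda>n. X n c) UNIV (points c)"
      and "indep_vars (\<lambda>_. borel) (\<lambda>n c. c (X n c)) UNIV"
    and space: "space M = configs"
    by (auto simp: compound_poisson_def)
  then have w[measurable]: "\<And>n. (\<lambda>c. c (X n c)) \<in> borel_measurable M"
    by (auto simp: indep_vars_def)
  have [measurable]: "Measurable.pred M (\<lambda>c. X m c \<le> X n c)" for m n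
  proof -
    define u v where "u n c = fst (X n c)" and "v n c = snd (X n c)" for n c
    have [measurable]: "u n \<in> borel_measurable M" "v n \<in> borel_measurable M" for n
      unfolding u_def v_def
      by (auto intro!: measurable_compose[OF X] borel_measurable_continuous_onI continuous_intros)
    have "Measurable.pred M (\<lambda>c. \<not> u n c < u m c \<and> \<not> v n c < v m c)"
      by measurable
    then show ?thesis by (simp add: u_def v_def less_eq_prod_def not_less)
  qed
  define good where "good F c \<longleftrightarrow> (\<forall>n\<in>F. X n c \<in> {p..q} - {p}) \<and>
    (\<forall>m\<in>F. \<forall>n\<in>F. X m c \<le> X n c \<or> X n c \<le> X m c)" for F c
  \<comment> \<open>Index sets that do not form a path contribute 0, which never exceeds the maximum
    since the empty path has weight 0.\<close>
  define g where "g F c = (if good F c then \<Sum>n\<in>F. c (X n c) else 0)" for F c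
  have [measurable]: "Measurable.pred M (good F)" if "finite F" for F
    unfolding good_def using that
    by (intro pred_intros_logic pred_intros_finite) measurable
  have [measurable]: "g F \<in> borel_measurable M" if "finite F" for F
    unfolding g_def using that by measurable
  \<comment> \<open>The supremum is taken in the extended reals, where it exists for every
    \<open>c\<close>, including those for which \<open>X\<close> fails to enumerate the
    points.\<close>
  define f where "f c = real_of_ereal (SUP F\<in>Collect finite. ereal (g F c))" for c
  have "f \<in> borel_measurable M"
    unfolding f_def using countable_Collect_finite
    by (intro borel_measurable_real_of_ereal borel_measurable_SUP borel_measurable_ereal) auto
  moreover have "AE c in M. last_passage c p q = f c"
    using bij AE_space
  proof eventually_elim
    case (elim c)
    then have c: "c \<in> configs" and inj: "inj (\<lambda>n. X n c)"
      and surj: "range (\<lambda>n. X n c) = points c"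
      using space by (simp_all add: bij_betw_def)
    from surj have X_in: "X n c \<in> points c" for n by blast
    have "(SUP F\<in>Collect finite. ereal (g F c)) = ereal (last_passage c p q)"
    proof (rule antisym)
      show "(SUP F\<in>Collect finite. ereal (g F c)) \<le> ereal (last_passage c p q)"
      proof (rule SUP_least)
        fix F :: "nat set" assume F: "F \<in> Collect finite"
        show "ereal (g F c) \<le> ereal (last_passage c p q)"
        proof (cases "good F c")
          case True
          then have "(\<lambda>n. X n c) ` F \<in> up_right_paths c p q"
            using X_in by (auto simp: good_def up_right_paths_def)
          then have "sum c ((\<lambda>n. X n c) ` F) \<le> last_passage c p q"
            using c by (rule last_passage_upper[rotated])
          then show ?thesis
            using True inj_on_subset[OF inj, of F] by (simp add: g_def sum.reindex)
        next
          case False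
          then show ?thesis
            using last_passage_upper[OF c empty_path] by (simp add: g_def)
        qed
      qed
      obtain S where S: "S \<in> up_right_paths c p q" "sum c S = last_passage c p q"
        using c by (rule last_passage_attained)
      define F where "F = (\<lambda>n. X n c) -` S"
      have "finite F"
        unfolding F_def using finite_up_right_paths(2)[OF c S(1)] inj by (rule finite_vimageI)
      have "S \<subseteq> points c"
        using S(1) by (auto simp: up_right_paths_def)
      then have img: "(\<lambda>n. X n c) ` F = S"
        unfolding F_def image_vimage_eq surj by blast
      have "good F c"
        using S(1) by (auto simp: good_def F_def up_right_paths_def)
      then have "g F c = sum c ((\<lambda>n. X n c) ` F)"
        using inj_on_subset[OF inj, of F] by (simp add: g_def sum.reindex)
      then have "g F c = last_passage c p q"
        by (simp add: img S(2))
      then show "ereal (last_passage c p q) \<le> (SUP F\<in>Collect finite. ereal (g F c))"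
        using \<open>finite F\<close> by (intro SUP_upper2[of F]) auto
    qed
    then show ?case by (simp add: f_def)
  qed
  ultimately show ?thesis by (rule that)
qed

text \<open>Each generating event differs by a null set from an event of the measurable function
  \<open>h\<close>. As \<open>\<nu> c\<close> is specified only almost surely, membership in the
  completion is what this yields.\<close>

lemma increment_events_completion:
  assumes model: "compound_poisson W M"
    and conv: "AE c in M. geodesics_converge \<alpha> c"
    and coal: "AE c in M. rays_coalesce \<alpha> c"
    and nu: "AE c in M. busemann_measure \<alpha> c (\<nu> c)"
  shows "increment_events M \<nu> \<subseteq> sets (completion M)"
proof -
  have "{c \<in> space M. emeasure (\<nu> c) {a<..b} \<in> U} \<in> sets (completion M)"
    if "a \<le> b" and [measurable]: "U \<in> sets borel" for a b :: real and U
  proof -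
    have "\<exists>f. f \<in> borel_measurable M \<and> (AE c in M. last_passage c (far_point \<alpha> n) p = f c)" for n p
      using last_passage_AE_measurable[OF model] by blast
    then obtain f where [measurable]: "\<And>n p. f n p \<in> borel_measurable M"
      and f: "\<And>n p. AE c in M. last_passage c (far_point \<alpha> n) p = f n p c"
      by metis
    define h where "h c = ennreal (lim (\<lambda>n. f n (b, 0) c - f n (a, 0) c))" for c
    have [measurable]: "h \<in> borel_measurable M"
      unfolding h_def by measurable
    \<comment> \<open>The exceptional null set depends on the pair of points. For fixed
      \<open>a\<close> and \<open>b\<close> only countably many pairs occur, so these sets can be
      united.\<close>
    have "AE c in M. \<forall>n. last_passage c (far_point \<alpha> n) (b, 0) = f n (b, 0) c"
      "AE c in M. \<forall>n. last_passage c (far_point \<alpha> n) (a, 0) = f n (a, 0) c"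
      using f by (simp_all add: AE_all_countable)
    then have "AE c in M. emeasure (\<nu> c) {a<..b} = h c"
      using conv coal nu AE_space
    proof eventually_elim
      case (elim c)
      then have "c \<in> configs" using model by (simp add: compound_poisson_def)
      then show ?case
        using elim \<open>a \<le> b\<close> by (simp add: busemann_measure_def busemann_eq_lim h_def)
    qed
    then have "AE c in M. c \<in> {c \<in> space M. h c \<in> U} \<longleftrightarrow>
        c \<in> {c \<in> space M. emeasure (\<nu> c) {a<..b} \<in> U}"
      by eventually_elim simp
    then have "AE c in completion M. c \<in> {c \<in> space M. h c \<in> U} \<longleftrightarrow>
        c \<in> {c \<in> space M. emeasure (\<nu> c) {a<..b} \<in> U}"
      by (rule AE_completion)
    moreover have "{c \<in> space M. h c \<in> U} \<in> sets (completion M)"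
      by (intro sets_completionI_sets) measurable
    ultimately show ?thesis
      by (rule completion.in_sets_AE) auto
  qed
  then have "{{c \<in> space M. emeasure (\<nu> c) {a<..b} \<in> U} | a b U. a \<le> b \<and> U \<in> sets borel}
      \<subseteq> sets (completion M)"
    by blast
  from sets.sigma_sets_subset[OF this] show ?thesis
    by (simp add: increment_events_def)
qed

section \<open>Marked points\<close>

lemma (in prob_space) indep_vars_reindex:
  assumes inj: "inj_on h I" and indep: "indep_vars N X (h ` I)"
  shows "indep_vars (\<lambda>i. N (h i)) (\<lambda>i. X (h i)) I"
  unfolding indep_vars_def2
proof (intro conjI indep_setsI)
  let ?F = "\<lambda>i. {X i -` A \<inter> space M | A. A \<in> sets (N i)}"
  have F: "indep_sets ?F (h ` I)" and rv: "\<forall>i\<in>I. random_variable (N (h i)) (X (h i))"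
    using indep by (auto simp: indep_vars_def2)
  show "\<forall>i\<in>I. random_variable (N (h i)) (X (h i))" by (rule rv)
  show "?F (h i) \<subseteq> events" if "i \<in> I" for i
    using F that by (auto simp: indep_sets_def)
  fix A J assume J: "J \<noteq> {}" "J \<subseteq> I" "finite J" and A: "\<forall>j\<in>J. A j \<in> ?F (h j)"
  have inj_J: "inj_on h J" using inj J(2) by (rule inj_on_subset)
  have "prob (\<Inter>k\<in>h ` J. A (inv_into J h k)) = (\<Prod>k\<in>h ` J. prob (A (inv_into J h k)))"
    using J A inj_J by (intro indep_setsD[OF F]) (auto simp: image_mono)
  then show "prob (\<Inter> (A ` J)) = (\<Prod>j\<in>J. prob (A j))"
    using inj_J by (simp add: prod.reindex image_image cong: INF_cong prod.cong)
qed

text \<open>This is the law of total probability over the countably many values of \<open>I\<close>.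
  It will be applied with \<open>I\<close> the indices of the points in the regions, determined by
  the positions, and \<open>A F\<close> an event about the weights.\<close>

lemma (in prob_space) emeasure_random_index:
  assumes C: "countable C" "AE c in M. I c \<in> C"
    and I: "\<And>F. F \<in> C \<Longrightarrow> {c \<in> space M. I c = F} \<in> events"
    and A: "\<And>F. F \<in> C \<Longrightarrow> A F \<in> events"
    and indep: "\<And>F. F \<in> C \<Longrightarrow> prob ({c \<in> space M. I c = F} \<inter> A F) = prob {c \<in> space M. I c = F} * prob (A F)"
  shows "emeasure M {c \<in> space M. I c \<in> C \<and> c \<in> A (I c)} = (\<integral>\<^sup>+c. emeasure M (A (I c)) \<partial>M)"
proof -
  have "{c \<in> space M. I c \<in> C \<and> c \<in> A (I c)} = (\<Union>F\<in>C. {c \<in> space M. I c = F} \<inter> A F)"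
    by auto
  then have "emeasure M {c \<in> space M. I c \<in> C \<and> c \<in> A (I c)} =
      (\<integral>\<^sup>+F. emeasure M ({c \<in> space M. I c = F} \<inter> A F) \<partial>count_space C)"
    using C(1) I A by (simp only:, intro emeasure_UN_countable) (auto simp: disjoint_family_on_def)
  also have "\<dots> = (\<integral>\<^sup>+F. (\<integral>\<^sup>+c. emeasure M (A F) * indicator {c \<in> space M. I c = F} c \<partial>M) \<partial>count_space C)"
    using I by (intro nn_integral_cong)
      (simp add: nn_integral_cmult_indicator emeasure_eq_measure indep ennreal_mult mult.commute)
  also have "\<dots> = (\<integral>\<^sup>+c. (\<integral>\<^sup>+F. emeasure M (A F) * indicator {c \<in> space M. I c = F} c \<partial>count_space C) \<partial>M)"
    using C(1) I by (intro nn_integral_count_space_nn_integral[symmetric]) auto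
  also have "\<dots> = (\<integral>\<^sup>+c. emeasure M (A (I c)) \<partial>M)"
  proof (rule nn_integral_cong_AE)
    show "AE c in M. (\<integral>\<^sup>+F. emeasure M (A F) * indicator {c \<in> space M. I c = F} c \<partial>count_space C) =
        emeasure M (A (I c))"
      using C(2) AE_space
    proof eventually_elim
      case (elim c)
      \<comment> \<open>For a fixed \<open>c\<close> only the value \<open>F = I c\<close>
        contributes.\<close>
      have "(\<integral>\<^sup>+F. emeasure M (A F) * indicator {c \<in> space M. I c = F} c \<partial>count_space C) =
          (\<Sum>F\<in>{I c}. emeasure M (A F) * indicator {c \<in> space M. I c = F} c)"
        using elim by (intro nn_integral_count_space') auto
      then show ?case using elim by simp
    qed
  qed
  finally show ?thesis .
qed

section \<open>Finite systems of count constraints and the atoms of their regions\<close>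

definition count_event ::
    "'j set \<Rightarrow> ('j \<Rightarrow> point set) \<Rightarrow> ('j \<Rightarrow> real set) \<Rightarrow> ('j \<Rightarrow> nat) \<Rightarrow> config set" where
  "count_event J D E k = {c \<in> configs. \<forall>j\<in>J. card {p \<in> D j. c p \<in> E j} = k j}"

definition regions :: "'j set \<Rightarrow> ('j \<Rightarrow> point set) \<Rightarrow> bool" where
  "regions J D \<longleftrightarrow> finite J \<and> (\<forall>j\<in>J. D j \<in> sets borel \<and> bounded (D j))"

text \<open>Positivity excludes the value 0, which encodes the absence of a point, so that only
  points of the process are counted.\<close>

definition mark_sets :: "'j set \<Rightarrow> ('j \<Rightarrow> real set) \<Rightarrow> bool" where
  "mark_sets J E \<longleftrightarrow> (\<forall>j\<in>J. E j \<in> sets borel \<and> E j \<subseteq> {0<..})"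

text \<open>
  The nonempty atoms \<open>atom J D S\<close> of the algebra generated by the regions are disjoint; their
  numbers of points determine the conditional law of all counts given the points.
\<close>

definition atom :: "'j set \<Rightarrow> ('j \<Rightarrow> 'a set) \<Rightarrow> 'j set \<Rightarrow> 'a set" where
  "atom J D S = {p. {j \<in> J. p \<in> D j} = S}"

text \<open>The empty type is left out: its atom is the complement of all regions, which is
  unbounded and affects no count.\<close>

abbreviation types :: "'j set \<Rightarrow> 'j set set" where
  "types J \<equiv> Pow J - {{}}"

lemma disjoint_atoms: "disjoint_family_on (atom J D) T"
  by (auto simp: disjoint_family_on_def atom_def)

lemma atom_subset: "S \<in> types J \<Longrightarrow> atom J D S \<subseteq> (\<Union>j\<in>J. D j)"
  by (auto simp: atom_def)

lemma regions_atom: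
  assumes "regions J D"
  shows "regions (types J) (atom J D)"
  unfolding regions_def
proof (intro conjI ballI)
  show "finite (types J)" using assms by (simp add: regions_def)
  fix S assume S: "S \<in> types J"
  have "atom J D S = (\<Inter>j\<in>J. if j \<in> S then D j else - D j)"
    using S by (auto simp: atom_def split: if_splits)
  also have "\<dots> \<in> sets borel"
    using assms S by (intro sets.finite_INT) (auto simp: regions_def)
  finally show "atom J D S \<in> sets borel" .
  have "bounded (\<Union>j\<in>J. D j)" using assms by (auto simp: regions_def)
  then show "bounded (atom J D S)" using atom_subset[OF S] by (rule bounded_subset)
qed

text \<open>Each \<open>F j\<close> is the disjoint union of the atoms whose type contains
  \<open>j\<close>. Bijections between corresponding atoms therefore glue to one map that respects
  all the sets \<open>F j\<close> at once, however they overlap.\<close>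

lemma bij_of_atom_cards:
  fixes F F' :: "'j \<Rightarrow> nat set"
  assumes fin: "finite J" "\<forall>j\<in>J. finite (F j)" "\<forall>j\<in>J. finite (F' j)"
    and card: "\<And>S. S \<in> types J \<Longrightarrow> card (atom J F S) = card (atom J F' S)"
  obtains \<sigma> where "bij_betw \<sigma> (\<Union>j\<in>J. F j) (\<Union>j\<in>J. F' j)"
    "\<And>j. j \<in> J \<Longrightarrow> bij_betw \<sigma> (F j) (F' j)"
proof -
  have finU: "finite (\<Union>j\<in>J. F j)" "finite (\<Union>j\<in>J. F' j)" using fin by auto
  have "\<exists>f. bij_betw f (atom J F S) (atom J F' S)" if "S \<in> types J" for S
    using that finite_subset[OF atom_subset[OF that] finU(1)] finite_subset[OF atom_subset[OF that] finU(2)]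
    by (intro finite_same_card_bij card)
  then obtain f where f: "\<And>S. S \<in> types J \<Longrightarrow> bij_betw (f S) (atom J F S) (atom J F' S)"
    by metis
  define ty where "ty G n = {j \<in> J. n \<in> G j}" for G :: "'j \<Rightarrow> nat set" and n
  have ty: "ty F n \<in> types J \<longleftrightarrow> n \<in> (\<Union>j\<in>J. F j)" for n by (auto simp: ty_def)
  have at: "n \<in> atom J G S \<longleftrightarrow> ty G n = S" for G n S by (simp add: atom_def ty_def)
  \<comment> \<open>Every index is moved by the bijection of its own atom, so
    \<open>\<sigma>\<close> preserves types.\<close>
  define \<sigma> where "\<sigma> n = f (ty F n) n" for n
  have ty_\<sigma>: "ty F' (\<sigma> n) = ty F n" if "n \<in> (\<Union>j\<in>J. F j)" for n
    using f[of "ty F n"] that ty[of n] unfolding \<sigma>_def bij_betw_def by (metis at image_eqI)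
  have inj: "inj_on \<sigma> (\<Union>j\<in>J. F j)"
  proof (rule inj_onI)
    fix m n assume *: "m \<in> (\<Union>j\<in>J. F j)" "n \<in> (\<Union>j\<in>J. F j)" "\<sigma> m = \<sigma> n"
    then have "ty F m = ty F n" using ty_\<sigma> by metis
    then show "m = n"
      using f[of "ty F n"] * ty[of n] unfolding \<sigma>_def bij_betw_def inj_on_def by (metis at)
  qed
  have image: "\<sigma> ` F j = F' j" if j: "j \<in> J" for j
  proof
    show "\<sigma> ` F j \<subseteq> F' j"
      using ty_\<sigma> j unfolding ty_def by fastforce
    show "F' j \<subseteq> \<sigma> ` F j"
    proof
      fix m assume m: "m \<in> F' j"
      then have S: "ty F' m \<in> types J" using j by (auto simp: ty_def)
      have "m \<in> f (ty F' m) ` atom J F (ty F' m)"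
        using f[OF S] unfolding bij_betw_def by (simp add: at)
      then obtain n where n: "m = f (ty F' m) n" "ty F n = ty F' m" by (auto simp: at)
      then have "\<sigma> n = m" by (simp add: \<sigma>_def)
      moreover have "n \<in> F j" using n(2) m j by (auto simp: ty_def)
      ultimately show "m \<in> \<sigma> ` F j" by blast
    qed
  qed
  show thesis
  proof
    show "bij_betw \<sigma> (\<Union>j\<in>J. F j) (\<Union>j\<in>J. F' j)"
      using inj image by (simp add: bij_betw_def image_UN)
    show "bij_betw \<sigma> (F j) (F' j)" if "j \<in> J" for j
      using inj_on_subset[OF inj, of "F j"] image[OF that] that by (auto simp: bij_betw_def)
  qed
qed

locale marked_poisson = prob_space M for M :: "config measure" +
  fixes W :: "real measure" and X :: "nat \<Rightarrow> config \<Rightarrow> point"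
  assumes space_configs: "space M = configs"
    and sets_config: "sets M = sets config_algebra"
    and poisson: "poisson_points M"
    and X_meas: "\<And>n. X n \<in> borel_measurable M"
    and X_bij: "AE c in M. bij_betw (\<lambda>n. X n c) UNIV (points c)"
    and marks_indep: "indep_vars (\<lambda>_. borel) (\<lambda>n c. c (X n c)) UNIV"
    and marks_distr: "\<And>n. distr M borel (\<lambda>c. c (X n c)) = W"
    and X_marks_indep: "indep_set
      (sets (vimage_algebra (space M) (\<lambda>c n. X n c) (\<Pi>\<^sub>M n\<in>UNIV. borel)))
      (sets (vimage_algebra (space M) (\<lambda>c n. c (X n c)) (\<Pi>\<^sub>M n\<in>UNIV. borel)))"
begin

lemma mark_meas: "random_variable borel (\<lambda>c. c (X n c))"
  using marks_indep by (auto simp: indep_vars_def)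

text \<open>This is the count event with deterministic index sets \<open>F j\<close> in place of the
  random indices of the points in the regions. It depends on the weights alone.\<close>

definition mark_event :: "'j set \<Rightarrow> ('j \<Rightarrow> real set) \<Rightarrow> ('j \<Rightarrow> nat) \<Rightarrow> ('j \<Rightarrow> nat set) \<Rightarrow> config set" where
  "mark_event J E k F = {c \<in> space M. \<forall>j\<in>J. card {n \<in> F j. c (X n c) \<in> E j} = k j}"

lemma card_pred_measurable:
  fixes E :: "real set"
  assumes "finite A" "A \<subseteq> U" and [measurable]: "E \<in> sets borel"
  shows "Measurable.pred (\<Pi>\<^sub>M n\<in>U. borel) (\<lambda>x. card {n \<in> A. x n \<in> E} = k)"
proof -
  have [measurable]: "(\<lambda>x. \<Sum>n\<in>A. indicat_real E (x n)) \<in> borel_measurable (\<Pi>\<^sub>M n\<in>U. borel)"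
    using assms
    by (intro borel_measurable_sum measurable_compose[OF measurable_component_singleton]) auto
  have "real (card {n \<in> A. x n \<in> E}) = (\<Sum>n\<in>A. indicat_real E (x n))" for x
    using assms(1) by (simp add: indicator_def sum.If_cases Int_def)
  then have "card {n \<in> A. x n \<in> E} = k \<longleftrightarrow> (\<Sum>n\<in>A. indicat_real E (x n)) = real k" for x
    by (metis of_nat_eq_iff)
  then show ?thesis by simp
qed

lemma mark_pred_measurable:
  assumes "finite J" "mark_sets J E" "\<And>j. j \<in> J \<Longrightarrow> finite (F j) \<and> F j \<subseteq> U"
  shows "{x \<in> space (\<Pi>\<^sub>M n\<in>U. borel). \<forall>j\<in>J. card {n \<in> F j. x n \<in> E j} = k j} \<in> sets (\<Pi>\<^sub>M n\<in>U. borel)"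
  using assms
  by (intro sets.sets_Collect_finite_All predE card_pred_measurable) (auto simp: mark_sets_def)

lemma mark_event_vimage:
  assumes "\<And>j. j \<in> J \<Longrightarrow> F j \<subseteq> U"
  shows "mark_event J E k F = (\<lambda>c. \<lambda>n\<in>U. c (X n c)) -`
    {x \<in> space (\<Pi>\<^sub>M n\<in>U. borel). \<forall>j\<in>J. card {n \<in> F j. x n \<in> E j} = k j} \<inter> space M"
proof -
  have "{n \<in> F j. (\<lambda>n\<in>U. c (X n c)) n \<in> E j} = {n \<in> F j. c (X n c) \<in> E j}" if "j \<in> J" for j c
    using assms[OF that] by auto
  then show ?thesis by (auto simp: mark_event_def space_PiM)
qed

lemma mark_event_meas:
  assumes "finite J" "mark_sets J E" "\<And>j. j \<in> J \<Longrightarrow> finite (F j)"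
  shows "mark_event J E k F \<in> sets (vimage_algebra (space M) (\<lambda>c n. c (X n c)) (\<Pi>\<^sub>M n\<in>UNIV. borel))"
    and "mark_event J E k F \<in> events"
proof -
  show *: "mark_event J E k F \<in> sets (vimage_algebra (space M) (\<lambda>c n. c (X n c)) (\<Pi>\<^sub>M n\<in>UNIV. borel))"
    using mark_event_vimage[of J F UNIV E k, unfolded restrict_UNIV]
      in_vimage_algebra[OF mark_pred_measurable[OF assms(1,2), of F UNIV k], of "\<lambda>c n. c (X n c)" "space M"]
      assms(3) by simp
  show "mark_event J E k F \<in> events"
    using * indep_setD_ev2[OF X_marks_indep] by blast
qed

text \<open>The i.i.d. weights are exchangeable: the right-hand side does not depend on the
  relabelling \<open>\<sigma>\<close>.\<close>

lemma marks_distr_PiM: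
  assumes "inj_on \<sigma> U"
  shows "distr M (\<Pi>\<^sub>M n\<in>U. borel) (\<lambda>c. \<lambda>n\<in>U. c (X (\<sigma> n) c)) = (\<Pi>\<^sub>M n\<in>U. W)"
proof (cases "U = {}")
  \<comment> \<open>The characterization of independence by product measures requires a nonempty
    index set.\<close>
  case True
  interpret W: prob_space W
    using prob_space_distr[OF mark_meas] by (simp add: marks_distr)
  show ?thesis
    using True by (intro measure_eqI)
      (auto dest!: subset_singletonD simp: PiM_empty emeasure_distr restrict_def emeasure_space_1 space_PiM)
next
  case False
  have "indep_vars (\<lambda>_. borel) (\<lambda>n c. c (X n c)) (\<sigma> ` U)"
    using marks_indep by (rule indep_vars_subset) simp
  from indep_vars_reindex[OF assms this] show ?thesis
    using False mark_meas by (subst (asm) indep_vars_iff_distr_eq_PiM) (simp_all add: marks_distr)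
qed

text \<open>A relabelling of the indices that matches atoms turns one event into the other, and it
  preserves the joint law of the weights.\<close>

lemma prob_mark_event_cong:
  assumes fin: "finite J" "\<forall>j\<in>J. finite (F j)" "\<forall>j\<in>J. finite (F' j)" and E: "mark_sets J E"
    and card: "\<And>S. S \<in> types J \<Longrightarrow> card (atom J F S) = card (atom J F' S)"
  shows "prob (mark_event J E k F) = prob (mark_event J E k F')"
proof -
  obtain \<sigma> where \<sigma>: "bij_betw \<sigma> (\<Union>j\<in>J. F j) (\<Union>j\<in>J. F' j)"
      "\<And>j. j \<in> J \<Longrightarrow> bij_betw \<sigma> (F j) (F' j)"
    using bij_of_atom_cards[OF fin card] by metis
  define U where "U = (\<Union>j\<in>J. F j)"
  define Z where "Z = {x \<in> space (\<Pi>\<^sub>M n\<in>U. borel). \<forall>j\<in>J. card {n \<in> F j. x n \<in> E j} = k j}"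
  have Z: "Z \<in> sets (\<Pi>\<^sub>M n\<in>U. borel)"
    unfolding Z_def using fin E by (intro mark_pred_measurable) (auto simp: U_def)
  have rv: "random_variable (\<Pi>\<^sub>M n\<in>U. borel) (\<lambda>c. \<lambda>n\<in>U. c (X (\<tau> n) c))" for \<tau>
    by (intro measurable_restrict mark_meas)
  have 1: "mark_event J E k F = (\<lambda>c. \<lambda>n\<in>U. c (X n c)) -` Z \<inter> space M"
    unfolding Z_def by (rule mark_event_vimage) (auto simp: U_def)
  have eq: "card {n \<in> F j. (\<lambda>n\<in>U. c (X (\<sigma> n) c)) n \<in> E j} = card {n \<in> F' j. c (X n c) \<in> E j}"
    if j: "j \<in> J" for j c
  proof (rule bij_betw_same_card)
    have "bij_betw \<sigma> {n \<in> F j. c (X (\<sigma> n) c) \<in> E j} {n \<in> F' j. c (X n c) \<in> E j}"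
      using \<sigma>(2)[OF j] by (auto simp: bij_betw_def inj_on_def)
    moreover have "{n \<in> F j. (\<lambda>n\<in>U. c (X (\<sigma> n) c)) n \<in> E j} = {n \<in> F j. c (X (\<sigma> n) c) \<in> E j}"
      using j by (auto simp: U_def)
    ultimately show "bij_betw \<sigma> {n \<in> F j. (\<lambda>n\<in>U. c (X (\<sigma> n) c)) n \<in> E j} {n \<in> F' j. c (X n c) \<in> E j}"
      by simp
  qed
  \<comment> \<open>The same set \<open>Z\<close> describes both events; only the weight read at
    index \<open>n\<close> changes, from that of point \<open>n\<close> to that of point
    \<open>\<sigma> n\<close>.\<close>
  have 2: "mark_event J E k F' = (\<lambda>c. \<lambda>n\<in>U. c (X (\<sigma> n) c)) -` Z \<inter> space M"
    unfolding mark_event_def Z_def vimage_def using eq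
    by (auto simp: space_PiM simp del: restrict_apply)
  have "prob (mark_event J E k F) = measure (distr M (\<Pi>\<^sub>M n\<in>U. borel) (\<lambda>c. \<lambda>n\<in>U. c (X n c))) Z"
    unfolding 1 using rv[of "\<lambda>n. n"] Z by (subst measure_distr) auto
  also have "\<dots> = measure (distr M (\<Pi>\<^sub>M n\<in>U. borel) (\<lambda>c. \<lambda>n\<in>U. c (X (\<sigma> n) c))) Z"
    using marks_distr_PiM[of \<sigma> U] marks_distr_PiM[of "\<lambda>n. n" U] \<sigma>(1)
    by (simp add: bij_betw_def U_def)
  also have "\<dots> = prob (mark_event J E k F')"
    unfolding 2 using rv Z by (subst measure_distr) auto
  finally show ?thesis .
qed

lemma prob_mark_event_Int:
  assumes J: "finite J" "mark_sets J E" "\<And>j. j \<in> J \<Longrightarrow> finite (F j)"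
    and J': "finite J'" "mark_sets J' E'" "\<And>j. j \<in> J' \<Longrightarrow> finite (F' j)"
    and disj: "(\<Union>j\<in>J. F j) \<inter> (\<Union>j\<in>J'. F' j) = {}"
  shows "prob (mark_event J E k F \<inter> mark_event J' E' k' F') =
    prob (mark_event J E k F) * prob (mark_event J' E' k' F')"
proof -
  let ?w = "\<lambda>n c. c (X n c)"
  define U U' where "U = (\<Union>j\<in>J. F j)" and "U' = (\<Union>j\<in>J'. F' j)"
  define Z where "Z = {x \<in> space (\<Pi>\<^sub>M n\<in>U. borel). \<forall>j\<in>J. card {n \<in> F j. x n \<in> E j} = k j}"
  define Z' where "Z' = {x \<in> space (\<Pi>\<^sub>M n\<in>U'. borel). \<forall>j\<in>J'. card {n \<in> F' j. x n \<in> E' j} = k' j}"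
  have Z: "Z \<in> sets (\<Pi>\<^sub>M n\<in>U. borel)"
    unfolding Z_def using J by (intro mark_pred_measurable) (auto simp: U_def)
  have Z': "Z' \<in> sets (\<Pi>\<^sub>M n\<in>U'. borel)"
    unfolding Z'_def using J' by (intro mark_pred_measurable) (auto simp: U'_def)
  have 1: "mark_event J E k F = (\<lambda>c. \<lambda>n\<in>U. c (X n c)) -` Z \<inter> space M"
    unfolding Z_def by (rule mark_event_vimage) (auto simp: U_def)
  have 2: "mark_event J' E' k' F' = (\<lambda>c. \<lambda>n\<in>U'. c (X n c)) -` Z' \<inter> space M"
    unfolding Z'_def by (rule mark_event_vimage) (auto simp: U'_def)
  have "indep_var (\<Pi>\<^sub>M n\<in>U. borel) (\<lambda>c. \<lambda>n\<in>U. c (X n c)) (\<Pi>\<^sub>M n\<in>U'. borel) (\<lambda>c. \<lambda>n\<in>U'. c (X n c))"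
    using indep_var_restrict[OF marks_indep, of U U'] disj by (simp add: U_def U'_def)
  from indep_varD[OF this Z Z'] show ?thesis
    unfolding 1 2 by (simp add: vimage_Times vimage_def Collect_conj_eq Int_ac)
qed

section \<open>The law of the counts\<close>

lemma count_event_meas:
  assumes "regions J D" "mark_sets J E"
  shows "count_event J D E k \<in> events"
proof -
  let ?G = "{{c \<in> configs. card {p \<in> D. c p \<in> E} = n} | D E n.
        D \<in> sets borel \<and> bounded D \<and> E \<in> sets borel \<and> E \<subseteq> {0<..}}"
  have "?G \<subseteq> Pow configs" by auto
  then have "{c \<in> configs. card {p \<in> D. c p \<in> E} = n} \<in> sets config_algebra"
    if "D \<in> sets borel" "bounded D" "E \<in> sets borel" "E \<subseteq> {0<..}" for D E n
    unfolding config_algebra_def using that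
    by (subst sets_measure_of) (auto intro!: sigma_sets.Basic)
  then have "{c \<in> space M. card {p \<in> D j. c p \<in> E j} = k j} \<in> events" if "j \<in> J" for j
    using assms that by (simp add: regions_def mark_sets_def space_configs sets_config)
  then have "{c \<in> space M. \<forall>j\<in>J. card {p \<in> D j. c p \<in> E j} = k j} \<in> events"
    using assms by (intro sets.sets_Collect_finite_All) (auto simp: regions_def)
  then show ?thesis by (simp add: count_event_def space_configs)
qed

section \<open>Conditioning on the indices of the points in the regions\<close>

definition hits :: "('j \<Rightarrow> point set) \<Rightarrow> config \<Rightarrow> 'j \<Rightarrow> nat set" where
  "hits D c j = {n. X n c \<in> D j}"

lemma atom_hits: "atom J (hits D c) S = hits (atom J D) c S"
  by (auto simp: atom_def hits_def)

lemma finite_hits: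
  assumes "c \<in> configs" "bij_betw (\<lambda>n. X n c) UNIV (points c)" "regions J D" "j \<in> J"
  shows "finite (hits D c j)"
proof -
  have "finite (points c \<inter> D j)"
    using assms(1,3,4) by (auto simp: configs_def regions_def)
  moreover have "hits D c j = (\<lambda>n. X n c) -` (points c \<inter> D j)"
    using assms(2) by (auto simp: hits_def bij_betw_def)
  ultimately show ?thesis
    using bij_betw_imp_inj_on[OF assms(2)] by (simp only: finite_vimageI)
qed

lemma card_hits:
  assumes "bij_betw (\<lambda>n. X n c) UNIV (points c)"
  shows "card (points c \<inter> D j) = card (hits D c j)"
proof -
  have "points c \<inter> D j = (\<lambda>n. X n c) ` hits D c j"
    using bij_betw_imp_surj_on[OF assms] unfolding hits_def vimage_def[symmetric] image_vimage_eq
    by blast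
  then show ?thesis
    by (simp add: card_image[OF inj_on_subset[OF bij_betw_imp_inj_on[OF assms] subset_UNIV]])
qed

lemma card_marked_hits:
  assumes "bij_betw (\<lambda>n. X n c) UNIV (points c)" "E j \<subseteq> {0<..}"
  shows "card {p \<in> D j. c p \<in> E j} = card {n \<in> hits D c j. c (X n c) \<in> E j}"
proof -
  have "{p \<in> D j. c p \<in> E j} \<subseteq> points c"
    using assms(2) by (auto simp: points_def)
  moreover have "{n \<in> hits D c j. c (X n c) \<in> E j} = (\<lambda>n. X n c) -` {p \<in> D j. c p \<in> E j}"
    by (auto simp: hits_def)
  ultimately have "{p \<in> D j. c p \<in> E j} = (\<lambda>n. X n c) ` {n \<in> hits D c j. c (X n c) \<in> E j}"
    using bij_betw_imp_surj_on[OF assms(1)] by (simp only: image_vimage_eq) blast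
  then show ?thesis
    by (simp add: card_image[OF inj_on_subset[OF bij_betw_imp_inj_on[OF assms(1)] subset_UNIV]])
qed

text \<open>Measurability with respect to the positions alone is what makes this event independent
  of the weights; membership in \<open>events\<close> would not suffice.\<close>

lemma hits_meas:
  assumes "regions J D"
  shows "{c \<in> space M. \<forall>j\<in>J. hits D c j = F j} \<in>
    sets (vimage_algebra (space M) (\<lambda>c n. X n c) (\<Pi>\<^sub>M n\<in>UNIV. borel))"
proof -
  let ?Z = "{x \<in> space (\<Pi>\<^sub>M n\<in>UNIV. borel). \<forall>j\<in>J. \<forall>n. x n \<in> D j \<longleftrightarrow> n \<in> F j}"
  have [measurable]: "Measurable.pred (\<Pi>\<^sub>M n\<in>UNIV. borel) (\<lambda>x. x n \<in> D j)" if "j \<in> J" for j and n :: nat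
    using assms that
    by (intro pred_sets2[of "D j" borel] measurable_component_singleton) (auto simp: regions_def)
  have "?Z \<in> sets (\<Pi>\<^sub>M n\<in>UNIV. borel)"
    using assms
    by (intro sets.sets_Collect_finite_All sets.sets_Collect_countable_All predE)
      (auto simp: regions_def)
  from in_vimage_algebra[OF this, of "\<lambda>c n. X n c" "space M"] show ?thesis
    by (rule back_subst[where P="\<lambda>A. A \<in> _"]) (auto simp: hits_def space_PiM)
qed

text \<open>The integrand is the conditional probability given the positions: the inner measure
  treats \<open>hits D c\<close> as deterministic, which is justified by the independence of
  positions and weights.\<close>

lemma emeasure_count_event:
  assumes D: "regions J D" and E: "mark_sets J E"
  shows "emeasure M (count_event J D E k) = (\<integral>\<^sup>+c. emeasure M (mark_event J E k (hits D c)) \<partial>M)"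
proof -
  define C where "C = (\<Pi>\<^sub>E j\<in>J. Collect (finite :: nat set \<Rightarrow> bool))"
  \<comment> \<open>Restriction to \<open>J\<close> makes the index family extensional, so that
    almost surely it takes values in the countable set \<open>C\<close>.\<close>
  define I where "I c = restrict (hits D c) J" for c
  have fin: "finite J" using D by (simp add: regions_def)
  have restr: "mark_event J E k (restrict F J) = mark_event J E k F" for F
    by (simp add: mark_event_def)
  have C: "countable C"
    unfolding C_def using fin by (intro countable_PiE countable_Collect_finite)
  have I_in: "AE c in M. I c \<in> C"
    using X_bij AE_space
    by eventually_elim (use D finite_hits space_configs in \<open>auto simp: C_def I_def\<close>)
  have I_eq: "{c \<in> space M. I c = F} = {c \<in> space M. \<forall>j\<in>J. hits D c j = F j}" if "F \<in> C" for F
    using that by (auto simp: I_def C_def fun_eq_iff PiE_def extensional_def)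
  have I_X: "{c \<in> space M. I c = F} \<in>
      sets (vimage_algebra (space M) (\<lambda>c n. X n c) (\<Pi>\<^sub>M n\<in>UNIV. borel))" if "F \<in> C" for F
    unfolding I_eq[OF that] using D by (rule hits_meas)
  have I_meas: "{c \<in> space M. I c = F} \<in> events" if "F \<in> C" for F
    using I_X[OF that] indep_setD_ev1[OF X_marks_indep] by blast
  have F_fin: "finite (F j)" if "F \<in> C" "j \<in> J" for F j
    using that by (auto simp: C_def)
  have A_meas: "mark_event J E k F \<in> events" if "F \<in> C" for F
    using fin E F_fin[OF that] by (rule mark_event_meas(2))
  have indep: "prob ({c \<in> space M. I c = F} \<inter> mark_event J E k F) =
      prob {c \<in> space M. I c = F} * prob (mark_event J E k F)" if "F \<in> C" for F
    using X_marks_indep I_X[OF that] mark_event_meas(1)[OF fin E F_fin[OF that]]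
    by (rule indep_setD)
  have "{c \<in> space M. I c \<in> C \<and> c \<in> mark_event J E k (I c)} =
      (\<Union>F\<in>C. {c \<in> space M. I c = F} \<inter> mark_event J E k F)"
    by auto
  then have meas: "{c \<in> space M. I c \<in> C \<and> c \<in> mark_event J E k (I c)} \<in> events"
    using C I_meas A_meas by auto
  have "AE c in M. c \<in> count_event J D E k \<longleftrightarrow>
      c \<in> {c \<in> space M. I c \<in> C \<and> c \<in> mark_event J E k (I c)}"
    using X_bij I_in AE_space
  proof eventually_elim
    case (elim c)
    have "card {p \<in> D j. c p \<in> E j} = card {n \<in> hits D c j. c (X n c) \<in> E j}" if "j \<in> J" for j
      using elim(1) E that by (intro card_marked_hits) (auto simp: mark_sets_def)
    then show ?case
      using elim by (simp add: count_event_def space_configs mark_event_def I_def)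
  qed
  then have "emeasure M (count_event J D E k) =
      emeasure M {c \<in> space M. I c \<in> C \<and> c \<in> mark_event J E k (I c)}"
    using count_event_meas[OF D E] meas by (rule emeasure_eq_AE)
  also have "\<dots> = (\<integral>\<^sup>+c. emeasure M (mark_event J E k (I c)) \<partial>M)"
    using C I_in I_meas A_meas indep by (rule emeasure_random_index)
  finally show ?thesis by (simp add: I_def restr)
qed

text \<open>
  The conditional probability of a count event given the points, as a function of the numbers of
  points in the atoms; by \<open>prob_mark_event_cong\<close> the choice of \<open>F\<close> is irrelevant.
\<close>

definition mark_prob :: "'j set \<Rightarrow> ('j \<Rightarrow> real set) \<Rightarrow> ('j \<Rightarrow> nat) \<Rightarrow> ('j set \<Rightarrow> nat) \<Rightarrow> real" where
  "mark_prob J E k v = prob (mark_event J E k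
     (SOME F. (\<forall>j\<in>J. finite (F j)) \<and> (\<forall>S\<in>types J. card (atom J F S) = v S)))"

lemma mark_prob_cong:
  assumes "\<And>S. S \<in> types J \<Longrightarrow> v S = v' S"
  shows "mark_prob J E k v = mark_prob J E k v'"
proof -
  have "(\<forall>S\<in>types J. card (atom J F S) = v S) \<longleftrightarrow> (\<forall>S\<in>types J. card (atom J F S) = v' S)" for F :: "'a \<Rightarrow> nat set"
    using assms by (intro ball_cong) auto
  then show ?thesis by (simp only: mark_prob_def)
qed

lemma prob_mark_event:
  fixes F :: "'j \<Rightarrow> nat set"
  assumes "finite J" "mark_sets J E" "\<forall>j\<in>J. finite (F j)"
    "\<And>S. S \<in> types J \<Longrightarrow> v S = card (atom J F S)"
  shows "prob (mark_event J E k F) = mark_prob J E k v"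
proof -
  let ?P = "\<lambda>F :: 'j \<Rightarrow> nat set. (\<forall>j\<in>J. finite (F j)) \<and> (\<forall>S\<in>types J. card (atom J F S) = v S)"
  have "?P F" using assms by auto
  then have "?P (SOME F. ?P F)" by (rule someI[of ?P F])
  then show ?thesis
    unfolding mark_prob_def using assms by (intro prob_mark_event_cong) auto
qed

lemma mark_prob_bounds: "0 \<le> mark_prob J E k v" "mark_prob J E k v \<le> 1"
  by (simp_all add: mark_prob_def)

section \<open>Joint law of the numbers of points in disjoint regions\<close>

lemma counts_indep:
  assumes B: "regions T B" and disj: "disjoint_family_on B T"
  shows "indep_vars (\<lambda>_. count_space UNIV) (\<lambda>S c. card (points c \<inter> B S)) T"
proof -
  define h where "h = to_nat_on T"
  have h: "inj_on h T"
    unfolding h_def using B by (intro inj_on_to_nat_on countable_finite) (auto simp: regions_def)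
  \<comment> \<open>The model gives independence for sequences of disjoint regions. The finite
    family is numbered by \<open>h\<close> and padded with empty sets, which keep the sequence
    disjoint and bounded.\<close>
  define D where "D n = (if n \<in> h ` T then B (inv_into T h n) else {})" for n
  have D_h: "D (h S) = B S" if "S \<in> T" for S
    using that h by (simp add: D_def)
  have "disjoint_family D"
    unfolding disjoint_family_on_def
  proof (intro ballI impI)
    fix m n :: nat assume "m \<noteq> n"
    show "D m \<inter> D n = {}"
    proof (cases "m \<in> h ` T \<and> n \<in> h ` T")
      case True
      then obtain S S' where "S \<in> T" "S' \<in> T" "m = h S" "n = h S'" by auto
      moreover from this have "S \<noteq> S'" using \<open>m \<noteq> n\<close> by blast
      ultimately show ?thesis
        using disj by (simp add: D_h disjoint_family_on_def)
    qed (auto simp: D_def)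
  qed
  moreover have "D n \<in> sets borel \<and> bounded (D n)" for n
    using B h by (auto simp: D_def regions_def)
  ultimately have "indep_vars (\<lambda>_. count_space UNIV) (\<lambda>n c. card (points c \<inter> D n)) UNIV"
    using poisson by (auto simp: poisson_points_def)
  then have "indep_vars (\<lambda>_. count_space UNIV) (\<lambda>n c. card (points c \<inter> D n)) (h ` T)"
    by (rule indep_vars_subset) simp
  from indep_vars_reindex[OF h this] show ?thesis
    by (rule iffD1[OF indep_vars_cong, rotated -1]) (simp_all add: D_h)
qed

lemma count_meas:
  assumes "B \<in> sets borel" "bounded B"
  shows "random_variable (count_space UNIV) (\<lambda>c. card (points c \<inter> B))"
  \<comment> \<open>Independence of a family includes the measurability of its members, so a family
    with one region suffices.\<close>
  using counts_indep[of "{()}" "\<lambda>_. B"] assms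
  by (simp add: regions_def disjoint_family_on_def indep_vars_def)

lemma counts_meas:
  assumes "regions T B"
  shows "random_variable (\<Pi>\<^sub>M S\<in>T. count_space UNIV) (\<lambda>c. \<lambda>S\<in>T. card (points c \<inter> B S))"
  using assms by (intro measurable_restrict count_meas) (auto simp: regions_def)

lemma count_distr_cong:
  assumes "B \<in> sets borel" "bounded B" "B' \<in> sets borel" "bounded B'"
    and "measure lborel B = measure lborel B'"
  shows "distr M (count_space UNIV) (\<lambda>c. card (points c \<inter> B)) =
    distr M (count_space UNIV) (\<lambda>c. card (points c \<inter> B'))"
proof (rule measure_eqI_countable[of _ UNIV])
  fix k :: nat
  have "emeasure (distr M (count_space UNIV) (\<lambda>c. card (points c \<inter> A))) {k} =
      ennreal (prob {c \<in> space M. card (points c \<inter> A) = k})" if "A \<in> sets borel" "bounded A" for A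
    using count_meas[OF that]
    by (simp add: emeasure_distr emeasure_eq_measure vimage_def Int_def conj_commute)
  moreover have "prob {c \<in> space M. card (points c \<inter> A) = k} =
      measure lborel A ^ k / fact k * exp (- measure lborel A)" if "A \<in> sets borel" "bounded A" for A
    using poisson that unfolding poisson_points_def by blast
  ultimately show "emeasure (distr M (count_space UNIV) (\<lambda>c. card (points c \<inter> B))) {k} =
      emeasure (distr M (count_space UNIV) (\<lambda>c. card (points c \<inter> B'))) {k}"
    using assms by simp
qed auto

text \<open>By independence the joint law is the product of the marginal laws, and each of these is
  Poisson with the area as parameter.\<close>

lemma counts_distr_cong:
  assumes B: "regions T B" "disjoint_family_on B T" and B': "regions T B'" "disjoint_family_on B' T"
    and eq: "\<And>S. S \<in> T \<Longrightarrow> measure lborel (B S) = measure lborel (B' S)"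
  shows "distr M (\<Pi>\<^sub>M S\<in>T. count_space UNIV) (\<lambda>c. \<lambda>S\<in>T. card (points c \<inter> B S)) =
    distr M (\<Pi>\<^sub>M S\<in>T. count_space UNIV) (\<lambda>c. \<lambda>S\<in>T. card (points c \<inter> B' S))"
proof (cases "T = {}")
  case False
  have *: "distr M (\<Pi>\<^sub>M S\<in>T. count_space UNIV) (\<lambda>c. \<lambda>S\<in>T. card (points c \<inter> A S)) =
      (\<Pi>\<^sub>M S\<in>T. distr M (count_space UNIV) (\<lambda>c. card (points c \<inter> A S)))"
    if "regions T A" "disjoint_family_on A T" for A
    using counts_indep[OF that] False that(1) count_meas
    by (subst (asm) indep_vars_iff_distr_eq_PiM') (auto simp: regions_def)
  show ?thesis
    unfolding *[OF B] *[OF B'] using B B' eq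
    by (intro PiM_cong count_distr_cong) (auto simp: regions_def)
qed (simp add: restrict_def)

text \<open>A finite product of countable discrete spaces is discrete. This makes
  \<open>mark_prob\<close> measurable in the counts although it is defined by a choice.\<close>

lemma counts_function_meas:
  fixes g :: "('s \<Rightarrow> nat) \<Rightarrow> real"
  assumes "finite T"
  shows "g \<in> borel_measurable (\<Pi>\<^sub>M S\<in>T. count_space UNIV)"
  using count_space_PiM_finite[of T "\<lambda>_. UNIV :: nat set"] assms by simp

lemma prob_mark_event_hits:
  assumes D: "regions J D" and E: "mark_sets J E"
    and c: "c \<in> configs" "bij_betw (\<lambda>n. X n c) UNIV (points c)"
  shows "prob (mark_event J E k (hits D c)) = mark_prob J E k (\<lambda>S. card (points c \<inter> atom J D S))"
  using D E finite_hits[OF c D] card_hits[OF c(2), of "atom J D"]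
  by (intro prob_mark_event) (auto simp: regions_def atom_hits)

lemma mark_prob_counts_meas:
  assumes "regions J D"
  shows "random_variable borel (\<lambda>c. mark_prob J E k (\<lambda>S. card (points c \<inter> atom J D S)))"
proof -
  have "random_variable borel (\<lambda>c. mark_prob J E k (\<lambda>S\<in>types J. card (points c \<inter> atom J D S)))"
    using assms
    by (intro measurable_compose[OF counts_meas[OF regions_atom[OF assms]] counts_function_meas])
      (auto simp: regions_def)
  also have "(\<lambda>c. mark_prob J E k (\<lambda>S\<in>types J. card (points c \<inter> atom J D S))) =
      (\<lambda>c. mark_prob J E k (\<lambda>S. card (points c \<inter> atom J D S)))"
    by (intro ext mark_prob_cong) simp
  finally show ?thesis .
qed

lemma prob_count_event:
  assumes D: "regions J D" and E: "mark_sets J E"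
  shows "prob (count_event J D E k) =
    expectation (\<lambda>c. mark_prob J E k (\<lambda>S. card (points c \<inter> atom J D S)))"
proof -
  have "ennreal (prob (count_event J D E k)) = (\<integral>\<^sup>+c. emeasure M (mark_event J E k (hits D c)) \<partial>M)"
    by (simp add: emeasure_count_event[OF D E] flip: emeasure_eq_measure)
  also have "\<dots> = (\<integral>\<^sup>+c. ennreal (mark_prob J E k (\<lambda>S. card (points c \<inter> atom J D S))) \<partial>M)"
  proof (rule nn_integral_cong_AE)
    show "AE c in M. emeasure M (mark_event J E k (hits D c)) =
        ennreal (mark_prob J E k (\<lambda>S. card (points c \<inter> atom J D S)))"
      using X_bij AE_space
      by eventually_elim (simp add: emeasure_eq_measure prob_mark_event_hits[OF D E] space_configs)
  qed
  also have "\<dots> = ennreal (expectation (\<lambda>c. mark_prob J E k (\<lambda>S. card (points c \<inter> atom J D S))))"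
    using mark_prob_bounds mark_prob_counts_meas[OF D]
    by (intro nn_integral_eq_integral integrable_const_bound[where B=1])
      (auto simp: mark_prob_bounds)
  finally show ?thesis
    by (subst (asm) ennreal_inj) (auto intro: integral_nonneg_AE simp: mark_prob_bounds)
qed

text \<open>The conditional probability given the positions is a fixed function of the numbers of
  points in the atoms, and their joint law depends only on the areas. Stationarity will follow from
  this.\<close>

lemma prob_count_event_cong:
  assumes D: "regions J D" and D': "regions J D'" and E: "mark_sets J E"
    and eq: "\<And>S. S \<in> types J \<Longrightarrow> measure lborel (atom J D S) = measure lborel (atom J D' S)"
  shows "prob (count_event J D E k) = prob (count_event J D' E k)"
proof -
  let ?P = "\<Pi>\<^sub>M S\<in>types J. count_space (UNIV :: nat set)"
  have *: "prob (count_event J D E k) = (\<integral>v. mark_prob J E k v \<partial>distr M ?P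
      (\<lambda>c. \<lambda>S\<in>types J. card (points c \<inter> atom J D S)))" if D: "regions J D" for D
  proof -
    have "prob (count_event J D E k) =
        expectation (\<lambda>c. mark_prob J E k (\<lambda>S\<in>types J. card (points c \<inter> atom J D S)))"
      unfolding prob_count_event[OF D E]
      by (intro Bochner_Integration.integral_cong refl mark_prob_cong) simp
    also have "\<dots> = (\<integral>v. mark_prob J E k v \<partial>distr M ?P
        (\<lambda>c. \<lambda>S\<in>types J. card (points c \<inter> atom J D S)))"
      using D counts_meas[OF regions_atom[OF D]]
      by (subst integral_distr[OF _ counts_function_meas]) (auto simp: regions_def)
    finally show ?thesis .
  qed
  show ?thesis
    unfolding *[OF D] *[OF D']
    by (subst counts_distr_cong[OF regions_atom[OF D] disjoint_atoms regions_atom[OF D'] disjoint_atoms])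
      (simp_all add: eq)
qed

text \<open>Independence is used twice. Given the positions, the two systems concern weights with
  disjoint indices, so the conditional probability factors into \<open>f c * f' c\<close>. The
  factors depend on the counts in two disjoint families of atoms, so their expectations factor as
  well. The disjoint sum of the index sets merges both systems into one.\<close>

lemma prob_count_event_Int:
  fixes D :: "'i \<Rightarrow> point set" and D' :: "'j \<Rightarrow> point set"
  assumes D: "regions J D" and E: "mark_sets J E" and D': "regions J' D'" and E': "mark_sets J' E'"
    and disj: "(\<Union>j\<in>J. D j) \<inter> (\<Union>j\<in>J'. D' j) = {}"
  shows "prob (count_event J D E k \<inter> count_event J' D' E' k') =
    prob (count_event J D E k) * prob (count_event J' D' E' k')"
proof -
  let ?J = "J <+> J'" and ?D = "case_sum D D'" and ?E = "case_sum E E'" and ?k = "case_sum k k'"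
  define f where "f c = mark_prob J E k (\<lambda>S. card (points c \<inter> atom J D S))" for c
  define f' where "f' c = mark_prob J' E' k' (\<lambda>S. card (points c \<inter> atom J' D' S))" for c
  have sumD: "regions ?J ?D" and sumE: "mark_sets ?J ?E"
    using D D' E E' by (auto simp: regions_def mark_sets_def subset_eq)
  have f_bounds: "0 \<le> f c" "f c \<le> 1" "0 \<le> f' c" "f' c \<le> 1" for c
    by (simp_all add: f_def f'_def mark_prob_bounds)
  have f_meas[measurable]: "random_variable borel f" "random_variable borel f'"
    unfolding f_def f'_def using D D' by (simp_all add: mark_prob_counts_meas)
  have "\<bar>f c * f' c\<bar> \<le> 1" for c
    using f_bounds by (simp add: abs_mult mult_le_one)
  then have f_int: "integrable M f" "integrable M f'" "integrable M (\<lambda>c. f c * f' c)"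
    using f_bounds by (simp_all add: integrable_const_bound[where B=1])

  define T where "T = types J <+> types J'"
  \<comment> \<open>The atoms of the two systems are kept separate instead of forming the atoms of
    the merged system: \<open>f\<close> and \<open>f'\<close> are functions of exactly these
    counts.\<close>
  define B where "B = case_sum (atom J D) (atom J' D')"
  have B: "regions T B"
    using regions_atom[OF D] regions_atom[OF D'] by (auto simp: regions_def T_def B_def)
  have cross: "atom J D S \<inter> atom J' D' S' = {}" if "S \<in> types J" "S' \<in> types J'" for S S'
    using Int_mono[OF atom_subset[OF that(1), of D] atom_subset[OF that(2), of D']] disj
    by (simp only: subset_empty)
  have disjD: "atom J D S \<inter> atom J D S' = {}" if "S \<noteq> S'" for S S'
    using disjoint_atoms[of J D UNIV] that by (simp add: disjoint_family_on_def)
  have disjD': "atom J' D' S \<inter> atom J' D' S' = {}" if "S \<noteq> S'" for S S'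
    using disjoint_atoms[of J' D' UNIV] that by (simp add: disjoint_family_on_def)
  have "disjoint_family_on B T"
    unfolding disjoint_family_on_def
  proof (intro ballI impI)
    fix S S' assume "S \<in> T" "S' \<in> T" "S \<noteq> S'"
    then show "B S \<inter> B S' = {}"
      unfolding T_def B_def
      by (elim PlusE) (simp_all only: sum.case sum.inject cross Int_commute[of "atom J' D' _" "atom J D _"]
          disjD disjD' simp_thms)
  qed
  from counts_indep[OF B this]
  have "indep_var (\<Pi>\<^sub>M S\<in>Inl ` types J. count_space UNIV) (\<lambda>c. \<lambda>S\<in>Inl ` types J. card (points c \<inter> B S))
      (\<Pi>\<^sub>M S\<in>Inr ` types J'. count_space UNIV) (\<lambda>c. \<lambda>S\<in>Inr ` types J'. card (points c \<inter> B S))"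
    by (rule indep_var_restrict) (auto simp: T_def)
  then have "indep_var
      borel ((\<lambda>v. mark_prob J E k (\<lambda>S. v (Inl S))) \<circ> (\<lambda>c. \<lambda>S\<in>Inl ` types J. card (points c \<inter> B S)))
      borel ((\<lambda>v. mark_prob J' E' k' (\<lambda>S. v (Inr S))) \<circ> (\<lambda>c. \<lambda>S\<in>Inr ` types J'. card (points c \<inter> B S)))"
    using D D' by (elim indep_var_compose[OF _ counts_function_meas counts_function_meas])
      (auto simp: regions_def)
  moreover have "(\<lambda>v. mark_prob J E k (\<lambda>S. v (Inl S))) \<circ> (\<lambda>c. \<lambda>S\<in>Inl ` types J. card (points c \<inter> B S)) = f"
    unfolding comp_def f_def by (intro ext mark_prob_cong) (auto simp: B_def)
  moreover have "(\<lambda>v. mark_prob J' E' k' (\<lambda>S. v (Inr S))) \<circ> (\<lambda>c. \<lambda>S\<in>Inr ` types J'. card (points c \<inter> B S)) = f'"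
    unfolding comp_def f'_def by (intro ext mark_prob_cong) (auto simp: B_def)
  ultimately have "indep_var borel f borel f'" by simp
  then have prod: "expectation (\<lambda>c. f c * f' c) = expectation f * expectation f'"
    using f_int by (intro indep_var_lebesgue_integral)

  have ball_Plus: "(\<forall>x\<in>?J. P x) \<longleftrightarrow> (\<forall>i\<in>J. P (Inl i)) \<and> (\<forall>j\<in>J'. P (Inr j))" for P
    by blast
  have mark_Int: "mark_event ?J ?E ?k (hits ?D c) =
      mark_event J E k (hits D c) \<inter> mark_event J' E' k' (hits D' c)" for c
    by (auto simp: mark_event_def hits_def ball_Plus)
  have ae: "AE c in M. emeasure M (mark_event ?J ?E ?k (hits ?D c)) = ennreal (f c * f' c)"
    using X_bij AE_space
  proof eventually_elim
    case (elim c)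
    then have c: "c \<in> configs" by (simp add: space_configs)
    have "(\<Union>j\<in>J. hits D c j) \<inter> (\<Union>j\<in>J'. hits D' c j) = {}"
      using disj by (auto simp: hits_def)
    then have "prob (mark_event J E k (hits D c) \<inter> mark_event J' E' k' (hits D' c)) =
        prob (mark_event J E k (hits D c)) * prob (mark_event J' E' k' (hits D' c))"
      using D E D' E' finite_hits[OF c elim(1) D] finite_hits[OF c elim(1) D']
      by (intro prob_mark_event_Int) (auto simp: regions_def)
    then show ?case
      using prob_mark_event_hits[OF D E c elim(1)] prob_mark_event_hits[OF D' E' c elim(1)]
      by (simp add: mark_Int emeasure_eq_measure f_def f'_def)
  qed
  have "count_event ?J ?D ?E ?k = count_event J D E k \<inter> count_event J' D' E' k'"
    by (auto simp: count_event_def ball_Plus)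
  then have "ennreal (prob (count_event J D E k \<inter> count_event J' D' E' k')) =
      (\<integral>\<^sup>+c. emeasure M (mark_event ?J ?E ?k (hits ?D c)) \<partial>M)"
    using emeasure_count_event[OF sumD sumE, of ?k] by (simp only: emeasure_eq_measure)
  also have "\<dots> = (\<integral>\<^sup>+c. ennreal (f c * f' c) \<partial>M)"
    using ae by (rule nn_integral_cong_AE)
  also have "\<dots> = ennreal (expectation (\<lambda>c. f c * f' c))"
    using f_int(3) f_bounds by (intro nn_integral_eq_integral) auto
  finally have "prob (count_event J D E k \<inter> count_event J' D' E' k') = expectation (\<lambda>c. f c * f' c)"
    using f_bounds by (subst (asm) ennreal_inj) (auto intro!: integral_nonneg_AE)
  then show ?thesis
    using prod prob_count_event[OF D E, of k] prob_count_event[OF D' E', of k']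
    unfolding f_def f'_def by simp
qed

section \<open>Translations\<close>

lemma translate_configs:
  assumes "c \<in> configs"
  shows "translate t c \<in> configs"
proof -
  have "finite (points (translate t c) \<inter> K)" if "bounded K" for K
  proof -
    have "finite (points c \<inter> (\<lambda>p. p - (t, 0)) ` K)"
      using assms bounded_translation_minus[OF that] by (auto simp: configs_def)
    moreover have "points (translate t c) \<inter> K \<subseteq>
        (\<lambda>p. p + (t, 0)) ` (points c \<inter> (\<lambda>p. p - (t, 0)) ` K)"
      by (force simp: points_def translate_def image_iff)
    ultimately show ?thesis by (meson finite_imageI finite_subset)
  qed
  then show ?thesis using assms by (simp add: configs_def translate_def)
qed

text \<open>The region moves opposite to the configuration: the translated points in
  \<open>D\<close> are the original points in \<open>shift t D\<close>.\<close>

definition shift :: "real \<Rightarrow> point set \<Rightarrow> point set" where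
  "shift t D = {p. p + (t, 0) \<in> D}"

lemma shift_eq_image: "shift t D = (\<lambda>p. p - (t, 0)) ` D"
  by (force simp: shift_def image_iff)

lemma shift_borel:
  assumes "D \<in> sets borel"
  shows "shift t D \<in> sets borel"
proof -
  have "(\<lambda>p. p + (t, 0)) \<in> borel_measurable (borel :: point measure)"
    by (intro borel_measurable_continuous_onI continuous_intros)
  from measurable_sets[OF this assms] show ?thesis
    by (simp add: shift_def vimage_def)
qed

lemma measure_shift:
  assumes "D \<in> sets borel"
  shows "measure lborel (shift t D) = measure lborel D"
proof -
  have "measure lborel D = measure (distr lborel borel ((+) (t, 0))) D"
    by (simp add: lborel_distr_plus)
  also have "\<dots> = measure lborel (shift t D)"
    using assms by (subst measure_distr) (auto simp: shift_def vimage_def add.commute)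
  finally show ?thesis by simp
qed

lemma regions_shift: "regions J D \<Longrightarrow> regions J (\<lambda>j. shift t (D j))"
  using bounded_translation_minus shift_borel
  by (auto simp: regions_def shift_eq_image[symmetric]) (simp add: shift_eq_image bounded_translation_minus)

lemma atom_shift: "atom J (\<lambda>j. shift t (D j)) S = shift t (atom J D S)"
  by (simp add: atom_def shift_def)

lemma translate_count_event:
  "translate_preimage M t (count_event J D E k) = count_event J (\<lambda>j. shift t (D j)) E k"
proof -
  have "card {p \<in> D. translate t c p \<in> E} = card {p \<in> shift t D. c p \<in> E}"
    for D :: "point set" and E c
  proof -
    have "{p \<in> D. translate t c p \<in> E} = (\<lambda>p. p + (t, 0)) ` {p \<in> shift t D. c p \<in> E}"
      by (force simp: translate_def shift_def image_iff)
    then show ?thesis by (simp add: card_image)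
  qed
  then show ?thesis
    using translate_configs by (auto simp: translate_preimage_def count_event_def space_configs)
qed

lemma prob_translate_count_event:
  assumes "regions J D" "mark_sets J E"
  shows "prob (translate_preimage M t (count_event J D E k)) = prob (count_event J D E k)"
  unfolding translate_count_event
  using assms regions_shift[OF assms(1)] regions_atom[OF assms(1)]
  by (intro prob_count_event_cong) (auto simp: atom_shift measure_shift regions_def)

text \<open>A common point \<open>p\<close> writes \<open>(t, 0)\<close> as the difference of a
  point of \<open>B\<close> and a point of \<open>A\<close>, which bounds \<open>t\<close> by the
  sum of the radii of the two sets.\<close>

lemma shift_eventually_disjoint:
  assumes "bounded A" "bounded B"
  shows "\<forall>\<^sub>F t in at_top. A \<inter> shift t B = {}"
proof -
  obtain a b where a: "\<And>p. p \<in> A \<Longrightarrow> norm p \<le> a" and b: "\<And>p. p \<in> B \<Longrightarrow> norm p \<le> b"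
    using assms by (auto simp: bounded_iff)
  have "A \<inter> shift t B = {}" if t: "t > a + b" for t
  proof -
    have "t \<le> a + b" if "p \<in> A" "p + (t, 0) \<in> B" for p
    proof -
      have "norm (t, 0 :: real) \<le> norm (p + (t, 0)) + norm p"
        using norm_triangle_ineq4[of "p + (t, 0)" p] by simp
      then have "\<bar>t\<bar> \<le> b + a"
        using a[OF that(1)] b[OF that(2)] by simp
      then show ?thesis by simp
    qed
    then show ?thesis using t by (force simp: shift_def)
  qed
  then show ?thesis by (rule eventually_mono[OF eventually_gt_at_top])
qed

text \<open>The index of a constraint is the constraint itself: a region, a set of weights and a count.\<close>

definition elementary_events :: "config set set" where
  "elementary_events = {count_event Q fst (fst \<circ> snd) (snd \<circ> snd) | Q.
     regions Q fst \<and> mark_sets Q (fst \<circ> snd)}"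

lemma elementary_events_sub: "elementary_events \<subseteq> Pow (space M)"
  by (auto simp: elementary_events_def count_event_def space_configs)

text \<open>Because every constraint is its own index, the union of two index sets imposes both
  systems at once; shared constraints do no harm.\<close>

lemma Int_stable_elementary_events: "Int_stable elementary_events"
proof (rule Int_stableI)
  fix A B assume "A \<in> elementary_events" "B \<in> elementary_events"
  then obtain Q R where "A = count_event Q fst (fst \<circ> snd) (snd \<circ> snd)" "regions Q fst"
      "mark_sets Q (fst \<circ> snd)" "B = count_event R fst (fst \<circ> snd) (snd \<circ> snd)" "regions R fst"
      "mark_sets R (fst \<circ> snd)"
    by (auto simp: elementary_events_def)
  then show "A \<inter> B \<in> elementary_events"
    unfolding elementary_events_def
    by (intro CollectI exI[of _ "Q \<union> R"]) (auto simp: count_event_def regions_def mark_sets_def)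
qed

lemma sets_elementary_events: "sets M = sigma_sets (space M) elementary_events"
proof
  have "elementary_events \<subseteq> events"
    using count_event_meas by (auto simp: elementary_events_def)
  then show "sigma_sets (space M) elementary_events \<subseteq> events"
    by (rule sets.sigma_sets_subset)
  let ?G = "{{c \<in> configs. card {p \<in> D. c p \<in> E} = n} | D E n.
        D \<in> sets borel \<and> bounded D \<and> E \<in> sets borel \<and> E \<subseteq> {0<..}}"
  have "?G \<subseteq> elementary_events"
  proof
    fix A assume "A \<in> ?G"
    then obtain D E n where *: "A = {c \<in> configs. card {p \<in> D. c p \<in> E} = n}"
        "D \<in> sets borel" "bounded D" "E \<in> sets borel" "E \<subseteq> {0<..}"
      by blast
    have "A = count_event {(D, E, n)} fst (fst \<circ> snd) (snd \<circ> snd)"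
      by (simp add: * count_event_def)
    moreover have "regions {(D, E, n)} fst" "mark_sets {(D, E, n)} (fst \<circ> snd)"
      using * by (simp_all add: regions_def mark_sets_def)
    ultimately show "A \<in> elementary_events"
      unfolding elementary_events_def by blast
  qed
  moreover have "sets M = sigma_sets (space M) ?G"
    unfolding sets_config config_algebra_def space_configs by (intro sets_measure_of) auto
  ultimately show "events \<subseteq> sigma_sets (space M) elementary_events"
    by (simp only: sigma_sets_mono')
qed

section \<open>Stationarity\<close>

lemma translate_measurable: "translate t \<in> measurable M M"
proof (rule measurable_sigma_sets[OF sets_elementary_events elementary_events_sub])
  show "translate t \<in> space M \<rightarrow> space M"
    by (simp add: space_configs translate_configs)
  fix A assume "A \<in> elementary_events"
  then obtain Q where Q: "A = count_event Q fst (fst \<circ> snd) (snd \<circ> snd)" "regions Q fst" "mark_sets Q (fst \<circ> snd)"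
    by (auto simp: elementary_events_def)
  have "translate t -` A \<inter> space M = translate_preimage M t A"
    by (auto simp: translate_preimage_def)
  also have "\<dots> \<in> events"
    unfolding Q(1) translate_count_event using Q regions_shift by (intro count_event_meas)
  finally show "translate t -` A \<inter> space M \<in> events" .
qed

lemma translate_preimage_eq: "translate_preimage M t A = translate t -` A \<inter> space M"
  by (auto simp: translate_preimage_def)

lemma translate_preimage_meas: "A \<in> events \<Longrightarrow> translate_preimage M t A \<in> events"
  unfolding translate_preimage_eq using translate_measurable by (rule measurable_sets)

lemma distr_translate: "distr M M (translate t) = M"
proof (rule measure_eqI_generator_eq[OF Int_stable_elementary_events elementary_events_sub _ _
      sets_elementary_events, where A="\<lambda>_. space M"])
  show "emeasure (distr M M (translate t)) A = emeasure M A" if "A \<in> elementary_events" for A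
  proof -
    have "A \<in> events" using that by (simp add: sets_elementary_events)
    then have "emeasure (distr M M (translate t)) A = emeasure M (translate_preimage M t A)"
      by (simp add: emeasure_distr translate_measurable translate_preimage_eq)
    also have "\<dots> = emeasure M A"
      using that prob_translate_count_event by (auto simp: elementary_events_def emeasure_eq_measure)
    finally show ?thesis .
  qed
  show "sets (distr M M (translate t)) = sigma_sets (space M) elementary_events"
    by (simp add: sets_elementary_events)
  \<comment> \<open>The whole space is the elementary event without constraints.\<close>
  have "space M = count_event {} fst (fst \<circ> snd) (snd \<circ> snd)"
    by (simp add: space_configs count_event_def)
  then show "range (\<lambda>_. space M) \<subseteq> elementary_events"
    unfolding elementary_events_def regions_def mark_sets_def by (auto intro!: exI[of _ "{}"])
qed (simp_all add: emeasure_eq_measure prob_space translate_measurable emeasure_distr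
      measurable_space[OF translate_measurable] vimage_def)

lemma prob_translate_preimage:
  assumes "A \<in> events"
  shows "prob (translate_preimage M t A) = prob A"
  using measure_distr[OF translate_measurable assms, of t]
  by (simp add: distr_translate translate_preimage_eq)

end

section \<open>Mixing\<close>

text \<open>The events with the asserted limit form a Dynkin class. The delicate case is a countable
  disjoint union, where limit and sum must be interchanged; the bound by \<open>prob A\<close>,
  uniform in \<open>t\<close>, provides a summable majorant. The constant \<open>l\<close> is the
  limit of the total mass, so both arguments of the mixing relation can be treated in this
  way.\<close>

lemma (in prob_space) tendsto_events_induct:
  fixes \<mu> :: "'t \<Rightarrow> 'a set \<Rightarrow> real"
  assumes G: "Int_stable G" "G \<subseteq> Pow (space M)" "sets M = sigma_sets (space M) G"
    and bounds: "\<And>t A. A \<in> events \<Longrightarrow> 0 \<le> \<mu> t A \<and> \<mu> t A \<le> prob A"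
    and compl: "\<And>t A. A \<in> events \<Longrightarrow> \<mu> t (space M - A) = \<mu> t (space M) - \<mu> t A"
    and union: "\<And>t A. disjoint_family A \<Longrightarrow> range A \<subseteq> events \<Longrightarrow>
      (\<lambda>i. \<mu> t (A i)) sums \<mu> t (\<Union>i::nat. A i)"
    and total: "((\<lambda>t. \<mu> t (space M)) \<longlongrightarrow> l) F"
    and basic: "\<And>A. A \<in> G \<Longrightarrow> ((\<lambda>t. \<mu> t A) \<longlongrightarrow> l * prob A) F"
    and F: "F \<noteq> bot"
    and A: "A \<in> events"
  shows "((\<lambda>t. \<mu> t A) \<longlongrightarrow> l * prob A) F"
  using G(1,2) A[unfolded G(3)]
proof (induction A rule: sigma_sets_induct_disjoint)
  case (basic A)
  then show ?case by (rule assms(8))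
next
  case empty
  have "\<mu> t {} = 0" for t using bounds[of "{}" t] by simp
  then show ?case by simp
next
  case (compl A)
  then have A: "A \<in> events" by (simp add: G(3))
  have "((\<lambda>t. \<mu> t (space M) - \<mu> t A) \<longlongrightarrow> l - l * prob A) F"
    by (intro tendsto_diff total compl.IH)
  then show ?case
    using A by (simp add: assms(5) prob_compl algebra_simps)
next
  case (union A)
  then have A: "range A \<subseteq> events" by (simp add: G(3))
  have sums: "(\<lambda>i. prob (A i)) sums prob (\<Union>i. A i)"
    using A union.hyps(1) by (rule finite_measure_UNION)
  have "((\<lambda>t. \<Sum>i. \<mu> t (A i)) \<longlongrightarrow> (\<Sum>i. l * prob (A i))) F"
  proof -
    have "\<forall>\<^sub>F (i, t) in at_top \<times>\<^sub>F F. norm (\<mu> t (A i)) \<le> prob (A i)"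
      using A bounds by (intro always_eventually) (auto simp: subset_iff)
    from tannerys_theorem[OF union.IH this sums_summable[OF sums] F] show ?thesis by blast
  qed
  then show ?case
    using sums_unique[OF assms(6)[OF union.hyps(1) A]] sums_unique[OF sums_mult[OF sums, of l]]
    by simp
qed

context marked_poisson
begin

text \<open>The Dynkin class argument handles one argument at a time: \<open>left\<close> fixes an
  elementary \<open>B\<close> and varies \<open>A\<close>, with limiting mass \<open>prob B\<close>;
  then an arbitrary \<open>A\<close> is fixed and \<open>B\<close> varies, with limiting mass
  \<open>prob A\<close>.\<close>

lemma mixing_events:
  assumes A: "A \<in> events" and B: "B \<in> events"
  shows "((\<lambda>t. prob (A \<inter> translate_preimage M t B)) \<longlongrightarrow> prob A * prob B) at_top"
proof -
  note pre[simp] = translate_preimage_meas prob_translate_preimage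
  have Int_meas: "A \<inter> translate_preimage M t B \<in> events" if "A \<in> events" "B \<in> events" for A B t
    using that by (intro sets.Int translate_preimage_meas)
  \<comment> \<open>These are the majorants for the two inductions; the bound by
    \<open>prob B\<close> rests on stationarity.\<close>
  have le: "prob (A \<inter> translate_preimage M t B) \<le> prob A"
    "prob (A \<inter> translate_preimage M t B) \<le> prob B" if "A \<in> events" "B \<in> events" for A B t
    using that finite_measure_mono[of "A \<inter> translate_preimage M t B" A]
      finite_measure_mono[of "A \<inter> translate_preimage M t B" "translate_preimage M t B"] by auto
  have basic: "((\<lambda>t. prob (A \<inter> translate_preimage M t B)) \<longlongrightarrow> prob A * prob B) at_top"
    if "A \<in> elementary_events" "B \<in> elementary_events" for A B
  proof -
    from that obtain Q R
      where Q: "A = count_event Q fst (fst \<circ> snd) (snd \<circ> snd)" "regions Q fst" "mark_sets Q (fst \<circ> snd)"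
        and R: "B = count_event R fst (fst \<circ> snd) (snd \<circ> snd)" "regions R fst" "mark_sets R (fst \<circ> snd)"
      by (auto simp: elementary_events_def)
    have "bounded (\<Union>q\<in>Q. fst q)" "bounded (\<Union>r\<in>R. fst r)"
      using Q(2) R(2) by (auto simp: regions_def)
    then have "\<forall>\<^sub>F t in at_top. (\<Union>q\<in>Q. fst q) \<inter> shift t (\<Union>r\<in>R. fst r) = {}"
      by (rule shift_eventually_disjoint)
    \<comment> \<open>Once the regions are disjoint, the product formula is exact, so no estimate of
      correlations is needed.\<close>
    then have "\<forall>\<^sub>F t in at_top. prob (A \<inter> translate_preimage M t B) = prob A * prob B"
    proof eventually_elim
      case (elim t)
      then have "(\<Union>q\<in>Q. fst q) \<inter> (\<Union>r\<in>R. shift t (fst r)) = {}"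
        by (auto simp: shift_def)
      then have "prob (A \<inter> translate_preimage M t B) = prob A * prob (translate_preimage M t B)"
        unfolding Q(1) R(1) translate_count_event
        using Q R regions_shift by (intro prob_count_event_Int)
      then show ?case
        unfolding R(1) by (simp only: prob_translate_count_event[OF R(2,3)])
    qed
    then show ?thesis by (rule tendsto_eventually)
  qed
  have left: "((\<lambda>t. prob (A \<inter> translate_preimage M t B)) \<longlongrightarrow> prob B * prob A) at_top"
    if B: "B \<in> elementary_events" and A: "A \<in> events" for A B
  proof -
    have B': "B \<in> events" using B by (simp add: sets_elementary_events)
    show ?thesis
    proof (rule tendsto_events_induct[OF Int_stable_elementary_events elementary_events_sub
          sets_elementary_events, where \<mu>="\<lambda>t A. prob (A \<inter> translate_preimage M t B)"])
      fix t A assume A: "A \<in> events"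
      show "0 \<le> prob (A \<inter> translate_preimage M t B) \<and> prob (A \<inter> translate_preimage M t B) \<le> prob A"
        using le(1)[OF A B'] by simp
      have "space M \<inter> translate_preimage M t B - A \<inter> translate_preimage M t B =
          (space M - A) \<inter> translate_preimage M t B" by auto
      then show "prob ((space M - A) \<inter> translate_preimage M t B) =
          prob (space M \<inter> translate_preimage M t B) - prob (A \<inter> translate_preimage M t B)"
        using sets.sets_into_space[OF A]
          finite_measure_Diff[OF Int_meas[OF sets.top B'] Int_meas[OF A B'], of t t]
        by (simp only: le_infI1 Int_mono subset_refl)
    next
      fix t and A :: "nat \<Rightarrow> config set" assume A: "disjoint_family A" "range A \<subseteq> events"
      have "A i \<inter> translate_preimage M t B \<in> events" for i
        using A(2) B' by (intro Int_meas) auto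
      moreover have "disjoint_family (\<lambda>i. A i \<inter> translate_preimage M t B)"
        using A(1) unfolding disjoint_family_on_def by blast
      ultimately have "(\<lambda>i. prob (A i \<inter> translate_preimage M t B)) sums
          prob (\<Union>i. A i \<inter> translate_preimage M t B)"
        by (intro finite_measure_UNION) (simp_all add: image_subset_iff)
      then show "(\<lambda>i. prob (A i \<inter> translate_preimage M t B)) sums prob ((\<Union>i. A i) \<inter> translate_preimage M t B)"
        by (simp only: Int_UN_distrib2 UN_simps)
    next
      have "space M \<inter> translate_preimage M t B = translate_preimage M t B" for t
        by (auto simp: translate_preimage_def)
      then show "((\<lambda>t. prob (space M \<inter> translate_preimage M t B)) \<longlongrightarrow> prob B) at_top"
        using B' by simp
    next
      show "((\<lambda>t. prob (A \<inter> translate_preimage M t B)) \<longlongrightarrow> prob B * prob A) at_top"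
        if "A \<in> elementary_events" for A
        using basic[OF that B] by (simp add: mult.commute)
    qed (simp_all add: A)
  qed
  show ?thesis
  proof (rule tendsto_events_induct[OF Int_stable_elementary_events elementary_events_sub
        sets_elementary_events, where \<mu>="\<lambda>t B. prob (A \<inter> translate_preimage M t B)"])
    fix t B assume B: "B \<in> events"
    show "0 \<le> prob (A \<inter> translate_preimage M t B) \<and> prob (A \<inter> translate_preimage M t B) \<le> prob B"
      using le(2)[OF A B] by simp
    have "A \<inter> translate_preimage M t (space M) - A \<inter> translate_preimage M t B =
        A \<inter> translate_preimage M t (space M - B)"
      by (auto simp: translate_preimage_def)
    moreover have "A \<inter> translate_preimage M t B \<subseteq> A \<inter> translate_preimage M t (space M)"
      using sets.sets_into_space[OF B] by (auto simp: translate_preimage_def)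
    ultimately show "prob (A \<inter> translate_preimage M t (space M - B)) =
        prob (A \<inter> translate_preimage M t (space M)) - prob (A \<inter> translate_preimage M t B)"
      using finite_measure_Diff[OF Int_meas[OF A sets.top] Int_meas[OF A B], of t t]
      by simp
  next
    fix t and B :: "nat \<Rightarrow> config set" assume B: "disjoint_family B" "range B \<subseteq> events"
    have "A \<inter> translate_preimage M t (B i) \<in> events" for i
      using A B(2) by (intro Int_meas) auto
    moreover have "disjoint_family (\<lambda>i. A \<inter> translate_preimage M t (B i))"
      using B(1) unfolding disjoint_family_on_def translate_preimage_def by blast
    ultimately have "(\<lambda>i. prob (A \<inter> translate_preimage M t (B i))) sums
        prob (\<Union>i. A \<inter> translate_preimage M t (B i))"
      by (intro finite_measure_UNION) (simp_all add: image_subset_iff)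
    moreover have "(\<Union>i. A \<inter> translate_preimage M t (B i)) = A \<inter> translate_preimage M t (\<Union>i. B i)"
      by (auto simp: translate_preimage_def)
    ultimately show "(\<lambda>i. prob (A \<inter> translate_preimage M t (B i))) sums
        prob (A \<inter> translate_preimage M t (\<Union>i. B i))"
      by simp
  next
    have "A \<inter> translate_preimage M t (space M) = A" for t
      using sets.sets_into_space[OF A] translate_configs
      by (auto simp: translate_preimage_def space_configs)
    then show "((\<lambda>t. prob (A \<inter> translate_preimage M t (space M))) \<longlongrightarrow> prob A) at_top"
      by simp
  next
    show "((\<lambda>t. prob (A \<inter> translate_preimage M t B)) \<longlongrightarrow> prob A * prob B) at_top"
      if "B \<in> elementary_events" for B
      using left[OF that A] by (simp add: mult.commute)
  qed (simp_all add: B)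
qed

section \<open>Passage to the completion\<close>

lemma translate_AE:
  assumes "AE c in M. P c"
  shows "AE c in M. P (translate t c)"
proof -
  \<comment> \<open>The exceptional set need not be an event, so it is covered by a null event,
    whose translates are null by stationarity.\<close>
  from assms obtain N where N: "{c \<in> space M. \<not> P c} \<subseteq> N" "N \<in> events" "prob N = 0"
    by (auto elim!: AE_E simp: emeasure_eq_measure)
  have "translate_preimage M t N \<in> null_sets M"
    using N by (auto simp: null_sets_def translate_preimage_meas emeasure_eq_measure prob_translate_preimage)
  moreover have "{c \<in> space M. \<not> P (translate t c)} \<subseteq> translate_preimage M t N"
    using N(1) translate_configs by (auto simp: translate_preimage_def space_configs)
  ultimately show ?thesis by (rule AE_I')
qed

text \<open>Both events are replaced by versions in \<open>events\<close>. The translate of a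
  version is a version of the translate, because translations preserve almost sure
  statements.\<close>

lemma mixing_completion:
  assumes A: "A \<in> sets (completion M)" and B: "B \<in> sets (completion M)"
  shows "((\<lambda>t. measure (completion M) (A \<inter> translate_preimage (completion M) t B))
    \<longlongrightarrow> measure (completion M) A * measure (completion M) B) at_top"
proof -
  have version: "\<exists>A'\<in>events. AE c in M. c \<in> A' \<longleftrightarrow> c \<in> A" if A: "A \<in> sets (completion M)" for A
  proof -
    from A obtain S N N' where "A = S \<union> N" "N \<subseteq> N'" "N' \<in> null_sets M" "S \<in> events"
      by (rule sets_completionE)
    then show ?thesis
      by (intro bexI[of _ S]) (auto dest!: AE_not_in elim: eventually_mono)
  qed
  obtain A' where A': "A' \<in> events" "AE c in M. c \<in> A' \<longleftrightarrow> c \<in> A"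
    using version[OF A] by blast
  obtain B' where B': "B' \<in> events" "AE c in M. c \<in> B' \<longleftrightarrow> c \<in> B"
    using version[OF B] by blast
  have pre: "translate_preimage (completion M) t B = translate_preimage M t B" for t
    by (simp add: translate_preimage_def)
  have eq: "measure (completion M) C = prob C'"
    if "C' \<in> events" and ae: "AE c in M. c \<in> C' \<longleftrightarrow> c \<in> C" and "C \<subseteq> space M" for C C'
  proof -
    have C: "C \<in> sets (completion M)"
      using AE_completion[OF ae] sets_completionI_sets[OF that(1)] that(3)
      by (intro completion.in_sets_AE[of C' C M]) simp_all
    have "measure (completion M) C' = measure (completion M) C"
      using AE_completion[OF ae] sets_completionI_sets[OF that(1)] C by (rule measure_eq_AE)
    then show ?thesis using that(1) by simp
  qed
  have sub: "A \<subseteq> space M" "B \<subseteq> space M"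
    using sets.sets_into_space[OF A] sets.sets_into_space[OF B] by simp_all
  have "measure (completion M) (A \<inter> translate_preimage M t B) = prob (A' \<inter> translate_preimage M t B')" for t
  proof (rule eq)
    show "A' \<inter> translate_preimage M t B' \<in> events"
      using A'(1) B'(1) by (intro sets.Int translate_preimage_meas)
    show "AE c in M. c \<in> A' \<inter> translate_preimage M t B' \<longleftrightarrow> c \<in> A \<inter> translate_preimage M t B"
      using A'(2) translate_AE[OF B'(2), of t]
      by eventually_elim (simp add: translate_preimage_def)
    show "A \<inter> translate_preimage M t B \<subseteq> space M"
      using sub by blast
  qed
  then show ?thesis
    using mixing_events[OF A'(1) B'(1)] eq[OF A' sub(1)] eq[OF B' sub(2)] by (simp add: pre)
qed

end

lemma compound_poisson_mixing:
  assumes "compound_poisson W M" "\<F> \<subseteq> sets (completion M)"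
  shows "mixing (completion M) \<F>"
proof -
  interpret prob_space M using assms(1) by (simp add: compound_poisson_def)
  obtain X where "marked_poisson_axioms M W X"
    using assms(1) unfolding compound_poisson_def marked_poisson_axioms_def by auto
  then interpret marked_poisson M W X
    by (intro marked_poisson.intro prob_space_axioms)
  show ?thesis
    using assms(2) mixing_completion by (simp add: mixing_def subset_eq)
qed

text \<open>For an invariant event, mixing with itself says that its probability equals its own
  square.\<close>

lemma mixing_imp_ergodic:
  assumes "mixing M \<F>"
  shows "ergodic M \<F>"
  unfolding ergodic_def
proof (intro ballI impI)
  fix A assume A: "A \<in> \<F>" "\<forall>t. translate_preimage M t A = A"
  have "((\<lambda>t. measure M (A \<inter> translate_preimage M t A)) \<longlongrightarrow> measure M A * measure M A) at_top"
    using assms A(1) by (simp add: mixing_def)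
  then have "((\<lambda>t::real. measure M A) \<longlongrightarrow> measure M A * measure M A) at_top"
    using A(2) by simp
  then have "measure M A = measure M A * measure M A"
    by (simp add: tendsto_const_iff)
  then show "measure M A = 0 \<or> measure M A = 1" by simp
qed

theorem proposition5p6:
  fixes W :: "real measure" and M :: "config measure"
    and \<alpha> :: real and \<nu> :: "config \<Rightarrow> real measure"
  assumes weights: "real_distribution W" "AE w in W. 0 < w"
      "\<exists>a>0. integrable W (\<lambda>w. exp (a * w))"
    and model: "compound_poisson W M"
    and angle: "pi < \<alpha>" "\<alpha> < 3 * pi / 2"
    and rays: "AE c in M. rays_exist_uniquely \<alpha> c"
      "AE c in M. geodesics_converge \<alpha> c"
      "AE c in M. rays_coalesce \<alpha> c"
    and nu: "AE c in M. busemann_measure \<alpha> c (\<nu> c)"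
  shows "increment_events M \<nu> \<subseteq> sets (completion M) \<and>
    mixing (completion M) (increment_events M \<nu>) \<and>
    ergodic (completion M) (increment_events M \<nu>)"
proof (intro conjI)
  show incr: "increment_events M \<nu> \<subseteq> sets (completion M)"
    using model rays(2,3) nu by (rule increment_events_completion)
  show mix: "mixing (completion M) (increment_events M \<nu>)"
    using model incr by (rule compound_poisson_mixing)
  show "ergodic (completion M) (increment_events M \<nu>)"
    using mix by (rule mixing_imp_ergodic)
qed

end
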